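(* Let $p$ be a prime and let $F$ be a free group. Let $w \in F\setminus\{1\}$, $u = \mathrm{root}(w)$ and $e = \mathrm{exp}(w)$. Then: (i) $\mathrm{Cl}_{\mathbf{G}_p}(\langle 1\rangle) = \langle 1\rangle$; (ii) $\langle w\rangle$ is $\mathbf{G}_p$-closed if and only if $e = p^s$ for some $s \geq 0$, if and only if the implication $v^q \in \langle w\rangle \Rightarrow v \in \langle w\rangle$ holds for all $v \in F$ and all primes $q \neq p$; (iii) $\mathrm{Cl}_{\mathbf{G}_p}(\langle w\rangle) = \langle u^{\nu_p(e)}\rangle$.
   Context: $\mathbf{G}_p$ denotes the pseudovariety of all finite $p$-groups. For $k \geq 1$, $\nu_p(k)$ denotes the largest power of $p$ dividing $k$ (the power itself, not the exponent). For a pseudovariety $\mathbf{V}$ of finite groups, the pro-$\mathbf{V}$ topology on a group $G$ is the coarsest topology making all homomorphisms from $G$ into (discrete) members of $\mathbf{V}$ continuous; equivalently, $G$ is a topological group in which the normal subgroups $K$ with $G/K \in \mathbf{V}$ form a basis of neighbourhoods of the identity. "$\mathbf{V}$-closed" means closed in the pro-$\mathbf{V}$ topology, and $\mathrm{Cl}_{\mathbf{V}}(S)$ denotes the closure of $S \subseteq F$ in the pro-$\mathbf{V}$ topology on $F$. For $w \in F \setminus\{1\}$, the exponent $\mathrm{exp}(w)$ is the maximum $r \geq 1$ such that $w = v^r$ for some $v \in F$, and $\mathrm{root}(w)$ is the (unique) element of $F$ with $w = \mathrm{root}(w)^{\mathrm{exp}(w)}$. *)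

theory Defs
  imports
    "HOL-Algebra.Generated_Groups"
    "HOL-Analysis.Function_Topology"
    "HOL-Computational_Algebra.Primes"
begin

text \<open>The letter \<open>(x, True)\<close> stands for \<open>x\<close> and \<open>(x, False)\<close> for the inverse of \<open>x\<close>.\<close>

definition letter_value :: "('a, 'b) monoid_scheme \<Rightarrow> 'a \<times> bool \<Rightarrow> 'a" where
  "letter_value G l = (if snd l then fst l else inv\<^bsub>G\<^esub> (fst l))"

definition word_value :: "('a, 'b) monoid_scheme \<Rightarrow> ('a \<times> bool) list \<Rightarrow> 'a" where
  "word_value G ls = foldr (\<lambda>l g. letter_value G l \<otimes>\<^bsub>G\<^esub> g) ls \<one>\<^bsub>G\<^esub>"

definition reduced_words :: "'a set \<Rightarrow> ('a \<times> bool) list set" where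
  "reduced_words X =
     {ls. fst ` set ls \<subseteq> X \<and>
          successively (\<lambda>l m. \<not> (fst l = fst m \<and> snd l \<noteq> snd m)) ls}"

text \<open>
  \<open>X\<close> is a basis of \<open>G\<close> if every element of \<open>G\<close> is the value of exactly one reduced word
  over \<open>X\<close>. The basis may be empty or infinite.
\<close>

definition free_basis :: "('a, 'b) monoid_scheme \<Rightarrow> 'a set \<Rightarrow> bool" where
  "free_basis G X \<longleftrightarrow>
     X \<subseteq> carrier G \<and> bij_betw (word_value G) (reduced_words X) (carrier G)"

definition free_group :: "('a, 'b) monoid_scheme \<Rightarrow> bool" where
  "free_group G \<longleftrightarrow> group G \<and> (\<exists>X. free_basis G X)"

text \<open>
  \<open>elem_exp G w\<close> is only meaningful when the exponents \<open>r\<close> with \<open>w = v\<^sup>r\<close> are bounded, and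
  \<open>elem_root G w\<close> only when the root is moreover unique, as is the case for \<open>w \<noteq> 1\<close> in a free group.
\<close>

definition elem_exp :: "('a, 'b) monoid_scheme \<Rightarrow> 'a \<Rightarrow> nat" where
  "elem_exp G w = (GREATEST r. r \<ge> 1 \<and> (\<exists>v\<in>carrier G. w = v [^]\<^bsub>G\<^esub> r))"

definition elem_root :: "('a, 'b) monoid_scheme \<Rightarrow> 'a \<Rightarrow> 'a" where
  "elem_root G w = (THE u. u \<in> carrier G \<and> w = u [^]\<^bsub>G\<^esub> elem_exp G w)"

text \<open>
  Every finite group is isomorphic to one with carrier in \<^typ>\<open>nat\<close>, so a class of finite groups
  closed under isomorphism is represented by its members of type \<^typ>\<open>nat monoid\<close>.
\<close>

definition pgroups :: "nat \<Rightarrow> nat monoid set" where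
  "pgroups p = {H. group H \<and> finite (carrier H) \<and> (\<exists>n. order H = p ^ n)}"

text \<open>
  The coarsest topology on \<open>G\<close> making all homomorphisms into discrete members of \<open>V\<close> continuous.
\<close>

definition pro_topology :: "nat monoid set \<Rightarrow> ('a, 'b) monoid_scheme \<Rightarrow> 'a topology" where
  "pro_topology V G =
     topology_generated_by
       {{x \<in> carrier G. h x \<in> A} |H h A. H \<in> V \<and> h \<in> hom G H \<and> A \<subseteq> carrier H}"

text \<open>The largest power of \<open>p\<close> dividing \<open>k\<close>, not its exponent.\<close>

definition p_part :: "nat \<Rightarrow> nat \<Rightarrow> nat" where
  "p_part p k = p ^ multiplicity p k"

end

theory Submission
  imports Defs "HOL-Algebra.Multiplicative_Group" "HOL-Algebra.Weak_Morphisms" "HOL-Number_Theory.Cong"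
begin

text \<open>
  A free group \<open>F\<close> is residually a finite \<open>p\<close>-group: write \<open>g \<noteq> 1\<close> as a product of syllables
  \<open>x\<^sub>1\<^bsup>e\<^sub>1\<^esup> \<dots> x\<^sub>n\<^bsup>e\<^sub>n\<^esup>\<close> with nonzero exponents and \<open>x\<^sub>i \<noteq> x\<^sub>i\<^sub>+\<^sub>1\<close>, and send a generator
  \<open>x\<close> to the unitriangular matrix of size \<open>n + 1\<close> over \<open>\<int>/p\<^sup>k\<close> with entry \<open>1\<close> at \<open>(i - 1, i)\<close>
  whenever \<open>x\<^sub>i = x\<close>; the top right entry of the image of \<open>g\<close> is \<open>e\<^sub>1 \<dots> e\<^sub>n\<close>, which is nonzero for
  large \<open>k\<close>. Hence the closure of \<open>\<langle>w\<rangle>\<close> lies in the centralizer of \<open>w\<close>, which is \<open>\<langle>u\<rangle>\<close>. A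
  \<open>p\<close>-quotient in which \<open>u\<close> has order larger than the \<open>p\<close>-part of \<open>e\<close> separates the remaining
  powers of \<open>u\<close> from \<open>\<langle>w\<rangle> = \<langle>u\<^sup>e\<rangle>\<close>. Conversely, the part of \<open>e\<close> prime to \<open>p\<close> is invertible
  modulo every \<open>p\<^sup>M\<close> and so is invisible in \<open>p\<close>-groups.
\<close>

section \<open>Words and free bases\<close>

definition flip :: "'a \<times> bool \<Rightarrow> 'a \<times> bool" where
  "flip l = (fst l, \<not> snd l)"

text \<open>The adjacency condition of \<open>reduced_words\<close> without the alphabet, so that
  words can be handled before a basis is fixed; \<open>reduced_words_iff\<close> links the
  two.\<close>

definition reduced :: "('a \<times> bool) list \<Rightarrow> bool" where
  "reduced = successively (\<lambda>l m. m \<noteq> flip l)"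

definition inv_word :: "('a \<times> bool) list \<Rightarrow> ('a \<times> bool) list" where
  "inv_word ls = rev (map flip ls)"

text \<open>In front of a reduced word a new letter can cause at most one cancellation, so on
  reduced words this is left multiplication by a letter in the free group.\<close>

fun push :: "'a \<times> bool \<Rightarrow> ('a \<times> bool) list \<Rightarrow> ('a \<times> bool) list" where
  "push l [] = [l]"
| "push l (m # ms) = (if m = flip l then ms else l # m # ms)"

definition reduce :: "('a \<times> bool) list \<Rightarrow> ('a \<times> bool) list" where
  "reduce ls = foldr push ls []"

text \<open>Reducedness of the doubled word also forbids cancellation between the two ends. This
  suffices for all powers to be reduced, see \<open>reduced_concat_replicate\<close>.\<close>

definition cyclically_reduced :: "('a \<times> bool) list \<Rightarrow> bool" where
  "cyclically_reduced ls \<longleftrightarrow> reduced (ls @ ls)"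

lemma flip_flip [simp]: "flip (flip l) = l"
  by (simp add: flip_def)

lemma fst_flip [simp]: "fst (flip l) = fst l"
  by (simp add: flip_def)

lemma flip_neq [simp]: "flip l \<noteq> l" "l \<noteq> flip l"
  by (auto simp: flip_def prod_eq_iff)

lemma reduced_words_iff: "ls \<in> reduced_words X \<longleftrightarrow> fst ` set ls \<subseteq> X \<and> reduced ls"
proof -
  have "(\<lambda>l m. \<not> (fst l = fst m \<and> snd l \<noteq> snd m)) = (\<lambda>(l :: 'a \<times> bool) m. m \<noteq> flip l)"
    by (auto simp: fun_eq_iff flip_def)
  then show ?thesis
    unfolding reduced_words_def reduced_def by (simp only: mem_Collect_eq)
qed

lemma reduced_Nil [simp]: "reduced []"
  by (simp add: reduced_def)

lemma reduced_Cons: "reduced (l # ls) \<longleftrightarrow> reduced ls \<and> (ls = [] \<or> hd ls \<noteq> flip l)"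
  by (auto simp: reduced_def successively_Cons)

lemma reduced_append:
  "reduced (xs @ ys) \<longleftrightarrow>
     reduced xs \<and> reduced ys \<and> (xs = [] \<or> ys = [] \<or> hd ys \<noteq> flip (last xs))"
  by (simp add: reduced_def successively_append_iff)

lemma not_reduced_split:
  assumes "\<not> reduced ls"
  obtains as l bs where "ls = as @ l # flip l # bs"
proof -
  have "\<exists>as l bs. ls = as @ l # flip l # bs"
    using assms
  proof (induction ls)
    case (Cons m ms)
    show ?case
    proof (cases "reduced ms")
      case True
      with Cons.prems have "m # ms = [] @ m # flip m # tl ms"
        by (cases ms) (auto simp: reduced_Cons)
      then show ?thesis by blast
    next
      case False
      with Cons.IH obtain as l bs where "ms = as @ l # flip l # bs" by blast
      then have "m # ms = (m # as) @ l # flip l # bs" by simp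
      then show ?thesis by blast
    qed
  qed simp
  then show ?thesis using that by blast
qed

lemma inv_word_Nil [simp]: "inv_word [] = []"
  by (simp add: inv_word_def)

lemma inv_word_eq_Nil_iff [simp]: "inv_word ls = [] \<longleftrightarrow> ls = []"
  by (simp add: inv_word_def)

lemma inv_word_Cons: "inv_word (l # ls) = inv_word ls @ [flip l]"
  by (simp add: inv_word_def)

lemma inv_word_inv_word [simp]: "inv_word (inv_word ls) = ls"
  by (simp add: inv_word_def rev_map comp_def)

lemma fst_set_inv_word [simp]: "fst ` set (inv_word ls) = fst ` set ls"
  by (simp add: inv_word_def image_image)

lemma hd_inv_word: "ls \<noteq> [] \<Longrightarrow> hd (inv_word ls) = flip (last ls)"
  by (simp add: inv_word_def hd_rev last_map)

lemma last_inv_word: "ls \<noteq> [] \<Longrightarrow> last (inv_word ls) = flip (hd ls)"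
  by (simp add: inv_word_def last_rev hd_map)

lemma reduced_inv_word [simp]: "reduced (inv_word ls) \<longleftrightarrow> reduced ls"
proof -
  have *: "reduced (inv_word ls)" if "reduced ls" for ls :: "('a \<times> bool) list"
    using that
  proof (induction ls)
    case (Cons l ls)
    then show ?case
      by (auto simp: inv_word_Cons reduced_append reduced_Cons last_inv_word)
  qed simp
  from *[of ls] *[of "inv_word ls"] show ?thesis by auto
qed

lemma length_push: "length (push l ls) \<le> Suc (length ls)"
  by (cases ls) auto

lemma reduced_push: "reduced ls \<Longrightarrow> reduced (push l ls)"
  by (cases ls) (auto simp: reduced_Cons)

lemma set_push: "set (push l ls) \<subseteq> insert l (set ls)"
  by (cases ls) auto

lemma reduced_reduce: "reduced (reduce ls)"
  by (induction ls) (auto simp: reduce_def reduced_push)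

lemma length_reduce: "length (reduce ls) \<le> length ls"
proof (induction ls)
  case (Cons l ls)
  then show ?case
    using length_push[of l "reduce ls"] by (simp add: reduce_def)
qed (simp add: reduce_def)

lemma set_reduce: "set (reduce ls) \<subseteq> set ls"
proof (induction ls)
  case (Cons l ls)
  then show ?case
    using set_push[of l "reduce ls"] by (auto simp: reduce_def)
qed (simp add: reduce_def)

lemma cyclically_reduced_iff:
  "cyclically_reduced ls \<longleftrightarrow> reduced ls \<and> (ls = [] \<or> hd ls \<noteq> flip (last ls))"
  by (auto simp: cyclically_reduced_def reduced_append)

text \<open>As long as the two end letters cancel each other, they are moved into \<open>c\<close>;
  the remaining word is shorter by two letters. The core \<open>m\<close> may be empty here.\<close>

lemma cyclic_reduction:
  assumes "reduced ls"
  obtains c m where "ls = c @ m @ inv_word c" "cyclically_reduced m"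
proof -
  have "\<exists>c m. ls = c @ m @ inv_word c \<and> cyclically_reduced m"
    using assms
  proof (induction "length ls" arbitrary: ls rule: less_induct)
    case less
    show ?case
    proof (cases "cyclically_reduced ls")
      case True
      then have "ls = [] @ ls @ inv_word [] \<and> cyclically_reduced ls" by simp
      then show ?thesis by blast
    next
      case False
      with less.prems have ne: "ls \<noteq> []" and h: "hd ls = flip (last ls)"
        by (auto simp: cyclically_reduced_iff)
      from ne obtain a as where as: "ls = a # as" by (cases ls) auto
      \<comment> \<open>A single letter cannot be its own inverse, so the two cancelling ends are
        different positions.\<close>
      with h have "as \<noteq> []" by auto
      with as h obtain bs where bs: "ls = a # bs @ [flip a]"
        by (metis append_butlast_last_id flip_flip last_ConsR list.sel(1))
      with less.prems have "reduced bs" by (auto simp: reduced_Cons reduced_append)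
      with less.hyps[of bs] bs obtain c m where
        "bs = c @ m @ inv_word c" "cyclically_reduced m" by auto
      with bs have "ls = (a # c) @ m @ inv_word (a # c) \<and> cyclically_reduced m"
        by (simp add: inv_word_Cons)
      then show ?thesis by blast
    qed
  qed
  then show ?thesis using that by blast
qed

lemma hd_concat_replicate: "n > 0 \<Longrightarrow> ls \<noteq> [] \<Longrightarrow> hd (concat (replicate n ls)) = hd ls"
  by (cases n) auto

lemma last_concat_replicate: "n > 0 \<Longrightarrow> ls \<noteq> [] \<Longrightarrow> last (concat (replicate n ls)) = last ls"
proof (induction n)
  case (Suc n)
  then show ?case by (cases n) auto
qed simp

lemma reduced_concat_replicate:
  assumes "cyclically_reduced ls"
  shows "reduced (concat (replicate n ls))"
proof (induction n)
  case (Suc n)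
  then show ?case
    using assms hd_concat_replicate[of n ls]
    by (cases "n = 0"; cases "ls = []") (auto simp: cyclically_reduced_iff reduced_append)
qed simp

section \<open>Values of words in a group\<close>

context group
begin

lemma letter_value_closed [simp]: "fst l \<in> carrier G \<Longrightarrow> letter_value G l \<in> carrier G"
  by (simp add: letter_value_def)

lemma letter_value_flip: "fst l \<in> carrier G \<Longrightarrow> letter_value G (flip l) = inv (letter_value G l)"
  by (simp add: letter_value_def flip_def)

lemma word_value_Nil [simp]: "word_value G [] = \<one>"
  by (simp add: word_value_def)

lemma word_value_Cons [simp]: "word_value G (l # ls) = letter_value G l \<otimes> word_value G ls"
  by (simp add: word_value_def)

lemma word_value_closed [simp]: "fst ` set ls \<subseteq> carrier G \<Longrightarrow> word_value G ls \<in> carrier G"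
  by (induction ls) auto

lemma word_value_append:
  "fst ` set xs \<subseteq> carrier G \<Longrightarrow> fst ` set ys \<subseteq> carrier G \<Longrightarrow>
     word_value G (xs @ ys) = word_value G xs \<otimes> word_value G ys"
  by (induction xs) (auto simp: m_assoc)

lemma word_value_inv_word:
  "fst ` set ls \<subseteq> carrier G \<Longrightarrow> word_value G (inv_word ls) = inv (word_value G ls)"
  by (induction ls) (auto simp: inv_word_Cons word_value_append letter_value_flip inv_mult_group)

lemma word_value_concat_replicate:
  "fst ` set ls \<subseteq> carrier G \<Longrightarrow> word_value G (concat (replicate n ls)) = word_value G ls [^] n"
proof (induction n)
  case (Suc n)
  then show ?case
    using nat_pow_Suc2[of "word_value G ls" n]
    by (subst replicate_Suc, subst concat.simps, subst word_value_append)
      (auto simp: set_replicate_conv_if)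
qed simp

lemma word_value_push:
  assumes "fst l \<in> carrier G" "fst ` set ls \<subseteq> carrier G"
  shows "word_value G (push l ls) = letter_value G l \<otimes> word_value G ls"
proof (cases ls)
  case (Cons m ms)
  with assms show ?thesis
    by (auto simp: letter_value_flip m_assoc[symmetric])
qed simp

lemma word_value_reduce:
  "fst ` set ls \<subseteq> carrier G \<Longrightarrow> word_value G (reduce ls) = word_value G ls"
proof (induction ls)
  case (Cons l ls)
  have "fst ` set (reduce ls) \<subseteq> carrier G"
    using Cons.prems set_reduce[of ls] by auto
  with Cons show ?case
    by (auto simp: reduce_def word_value_push)
qed (simp add: reduce_def)

end

text \<open>Since \<open>apfst f\<close> commutes with \<open>flip\<close>, substitution sends a
  cancelling pair to a pair with product one in \<open>H\<close>, for an arbitrary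
  \<open>f\<close>.\<close>

lemma word_value_map_push:
  assumes "group H" "f ` insert (fst l) (fst ` set ls) \<subseteq> carrier H"
  shows "word_value H (map (apfst f) (push l ls)) =
    letter_value H (apfst f l) \<otimes>\<^bsub>H\<^esub> word_value H (map (apfst f) ls)"
proof (cases ls)
  case (Cons m ms)
  interpret H: group H by fact
  have [simp]: "apfst f (flip l) = flip (apfst f l)" for l
    by (simp add: flip_def prod_eq_iff)
  from Cons assms(2) show ?thesis
    by (auto simp: H.letter_value_flip H.m_assoc[symmetric] image_image)
qed (use assms in \<open>simp_all add: word_value_def\<close>)

lemma word_value_map_reduce:
  assumes "group H" "f ` fst ` set ls \<subseteq> carrier H"
  shows "word_value H (map (apfst f) (reduce ls)) = word_value H (map (apfst f) ls)"
  using assms(2)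
proof (induction ls)
  case (Cons l ls)
  interpret H: group H by fact
  have "f ` insert (fst l) (fst ` set (reduce ls)) \<subseteq> carrier H"
    using Cons.prems set_reduce[of ls] by auto
  with Cons show ?case
    using word_value_map_push[OF assms(1), of f l "reduce ls"]
    by (auto simp: reduce_def)
qed (simp add: reduce_def)

section \<open>Normal forms over a basis and the universal property\<close>

locale based_free_group = group +
  fixes X
  assumes basis: "free_basis G X"
begin

definition nf :: "'a \<Rightarrow> ('a \<times> bool) list" where
  "nf = inv_into (reduced_words X) (word_value G)"

lemma basis_subset: "X \<subseteq> carrier G"
  using basis by (simp add: free_basis_def)

lemma word_value_bij: "bij_betw (word_value G) (reduced_words X) (carrier G)"
  using basis by (simp add: free_basis_def)

lemma nf_reduced_words: "g \<in> carrier G \<Longrightarrow> nf g \<in> reduced_words X"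
  unfolding nf_def using word_value_bij by (metis bij_betw_def inv_into_into)

lemma nf_letters: "g \<in> carrier G \<Longrightarrow> fst ` set (nf g) \<subseteq> X"
  and reduced_nf: "g \<in> carrier G \<Longrightarrow> reduced (nf g)"
  using nf_reduced_words[of g] by (auto simp: reduced_words_iff)

lemma nf_letters_carrier: "g \<in> carrier G \<Longrightarrow> fst ` set (nf g) \<subseteq> carrier G"
  using nf_letters basis_subset by blast

lemma word_value_nf [simp]: "g \<in> carrier G \<Longrightarrow> word_value G (nf g) = g"
  unfolding nf_def using word_value_bij by (metis bij_betw_def f_inv_into_f)

lemma nf_word_value:
  "fst ` set ls \<subseteq> X \<Longrightarrow> reduced ls \<Longrightarrow> nf (word_value G ls) = ls"
  unfolding nf_def using word_value_bij
  by (metis bij_betw_def inv_into_f_f reduced_words_iff)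

lemma nf_word_value_reduce:
  assumes "fst ` set ls \<subseteq> X"
  shows "nf (word_value G ls) = reduce ls"
proof -
  have "fst ` set (reduce ls) \<subseteq> X"
    using assms set_reduce[of ls] by auto
  moreover have "word_value G (reduce ls) = word_value G ls"
    using assms basis_subset by (intro word_value_reduce) blast
  ultimately show ?thesis
    using nf_word_value[of "reduce ls"] reduced_reduce[of ls] by simp
qed

lemma length_nf_word_value: "fst ` set ls \<subseteq> X \<Longrightarrow> length (nf (word_value G ls)) \<le> length ls"
  by (simp add: nf_word_value_reduce length_reduce)

text \<open>One cancelling pair can be deleted without changing the value. The strict drop in length
  later detects cancellation by comparing lengths.\<close>

lemma length_nf_less:
  assumes "fst ` set ls \<subseteq> X" "\<not> reduced ls"
  shows "length (nf (word_value G ls)) < length ls"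
proof -
  from assms(2) obtain as l bs where ls: "ls = as @ l # flip l # bs"
    by (rule not_reduced_split)
  have cl: "fst ` set as \<subseteq> carrier G" "fst l \<in> carrier G" "fst ` set bs \<subseteq> carrier G"
    using assms(1) ls basis_subset by auto
  then have "word_value G ls = word_value G (as @ bs)"
    unfolding ls by (simp add: word_value_append letter_value_flip m_assoc[symmetric])
  with assms(1) ls length_nf_word_value[of "as @ bs"] show ?thesis by auto
qed

lemma nf_eq_iff: "g \<in> carrier G \<Longrightarrow> h \<in> carrier G \<Longrightarrow> nf g = nf h \<longleftrightarrow> g = h"
  by (metis word_value_nf)

lemma nf_one [simp]: "nf \<one> = []"
  using nf_word_value[of "[]"] by simp

lemma nf_eq_Nil_iff: "g \<in> carrier G \<Longrightarrow> nf g = [] \<longleftrightarrow> g = \<one>"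
  using nf_eq_iff[of g \<one>] by simp

lemma nf_inv: "g \<in> carrier G \<Longrightarrow> nf (inv g) = inv_word (nf g)"
  using nf_word_value[of "inv_word (nf g)"] nf_letters[of g] reduced_nf[of g]
    word_value_inv_word[of "nf g"] nf_letters_carrier[of g]
  by simp

lemma mult_eq_word_value:
  "g \<in> carrier G \<Longrightarrow> h \<in> carrier G \<Longrightarrow> word_value G (nf g @ nf h) = g \<otimes> h"
  by (simp add: word_value_append nf_letters_carrier)

text \<open>The homomorphism of the universal property: \<open>f\<close> is substituted into the
  normal form.\<close>

definition extension :: "('c, 'd) monoid_scheme \<Rightarrow> ('a \<Rightarrow> 'c) \<Rightarrow> 'a \<Rightarrow> 'c" where
  "extension H f g = word_value H (map (apfst f) (nf g))"

text \<open>The normal form of a product is the reduction of the concatenated normal forms, and by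
  \<open>word_value_map_reduce\<close> this reduction does not affect the value in
  \<open>H\<close>.\<close>

lemma extension_hom:
  assumes "group H" "f ` X \<subseteq> carrier H"
  shows "extension H f \<in> hom G H"
proof (rule homI)
  interpret H: group H by fact
  have cl: "f ` fst ` set (nf g) \<subseteq> carrier H" if "g \<in> carrier G" for g
    using nf_letters[OF that] assms(2) by blast
  have cl': "fst ` set (map (apfst f) (nf g)) \<subseteq> carrier H" if "g \<in> carrier G" for g
    using cl[OF that] by (simp add: image_image)
  show "extension H f g \<in> carrier H" if "g \<in> carrier G" for g
    unfolding extension_def using cl'[OF that] by (rule H.word_value_closed)
  show "extension H f (g \<otimes> h) = extension H f g \<otimes>\<^bsub>H\<^esub> extension H f h"
    if "g \<in> carrier G" "h \<in> carrier G" for g h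
  proof -
    have "nf (g \<otimes> h) = reduce (nf g @ nf h)"
      using nf_word_value_reduce[of "nf g @ nf h"] that nf_letters[of g] nf_letters[of h]
      by (simp add: image_Un mult_eq_word_value)
    then have "extension H f (g \<otimes> h) = word_value H (map (apfst f) (nf g @ nf h))"
      using word_value_map_reduce[OF assms(1), of f "nf g @ nf h"] cl that
      by (simp add: extension_def image_Un)
    also have "\<dots> = extension H f g \<otimes>\<^bsub>H\<^esub> extension H f h"
      unfolding extension_def map_append using cl' that by (intro H.word_value_append)
    finally show ?thesis .
  qed
qed

lemma extension_basis:
  assumes "group H" "x \<in> X" "f x \<in> carrier H"
  shows "extension H f x = f x"
proof -
  interpret H: group H by fact
  have "nf x = [(x, True)]"
    using nf_word_value[of "[(x, True)]"] assms(2) basis_subset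
    by (auto simp: reduced_Cons letter_value_def)
  with assms show ?thesis
    by (simp add: extension_def letter_value_def)
qed

end

section \<open>Roots and centralizers in free groups\<close>

lemma (in group) conj_hom: "c \<in> carrier G \<Longrightarrow> (\<lambda>x. c \<otimes> x \<otimes> inv c) \<in> hom G G"
proof (rule homI)
  fix x y assume [simp]: "c \<in> carrier G" "x \<in> carrier G" "y \<in> carrier G"
  have "inv c \<otimes> (c \<otimes> (y \<otimes> inv c)) = y \<otimes> inv c"
    by (simp add: m_assoc[symmetric])
  then show "c \<otimes> (x \<otimes> y) \<otimes> inv c = (c \<otimes> x \<otimes> inv c) \<otimes> (c \<otimes> y \<otimes> inv c)"
    by (simp add: m_assoc)
qed simp

lemma (in group) conj_nat_pow:
  "c \<in> carrier G \<Longrightarrow> x \<in> carrier G \<Longrightarrow> (c \<otimes> x \<otimes> inv c) [^] (n::nat) = c \<otimes> x [^] n \<otimes> inv c"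
  using hom_nat_pow[OF conj_hom, of c x n] is_group by simp

lemma (in group) conj_int_pow:
  "c \<in> carrier G \<Longrightarrow> x \<in> carrier G \<Longrightarrow> (c \<otimes> x \<otimes> inv c) [^] (n::int) = c \<otimes> x [^] n \<otimes> inv c"
  using hom_int_pow[OF conj_hom, of c x n] is_group by simp

lemma (in group) conj_conj_inv:
  "c \<in> carrier G \<Longrightarrow> x \<in> carrier G \<Longrightarrow> c \<otimes> (inv c \<otimes> x \<otimes> c) \<otimes> inv c = x"
  by (simp add: m_assoc) (simp add: m_assoc[symmetric])

lemma (in group) inv_commute:
  assumes "x \<in> carrier G" "y \<in> carrier G" "x \<otimes> y = y \<otimes> x"
  shows "x \<otimes> inv y = inv y \<otimes> x"
proof -
  have "x = inv y \<otimes> (y \<otimes> x)" using assms by (simp add: m_assoc[symmetric])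
  also have "\<dots> = inv y \<otimes> x \<otimes> y" using assms by (simp add: m_assoc)
  finally have "x \<otimes> inv y = inv y \<otimes> x \<otimes> y \<otimes> inv y" by (rule arg_cong)
  then show ?thesis using assms(1,2) by (simp add: m_assoc)
qed

lemma (in group) int_pow_commute:
  "x \<in> carrier G \<Longrightarrow> x [^] (i::int) \<otimes> x [^] (j::int) = x [^] j \<otimes> x [^] i"
  by (simp add: int_pow_mult[symmetric] add.commute)

lemma (in group) int_pow_pow_commute:
  "x \<in> carrier G \<Longrightarrow> (x [^] (i::int)) [^] (j::int) = (x [^] j) [^] i"
  by (simp add: int_pow_pow mult.commute)

section \<open>Powers, unique roots and commuting elements\<close>

context based_free_group
begin

lemma obtain_cyclic_reduction:
  assumes "x \<in> carrier G" "x \<noteq> \<one>"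
  obtains c m where "nf x = c @ m @ inv_word c" "cyclically_reduced m" "m \<noteq> []"
proof -
  obtain c m where cm: "nf x = c @ m @ inv_word c" "cyclically_reduced m"
    using cyclic_reduction[OF reduced_nf[OF assms(1)]] .
  moreover have "m \<noteq> []"
  proof
    assume "m = []"
    \<comment> \<open>With an empty core, the last letter of \<open>c\<close> would meet its own
      inverse in the reduced word \<open>c @ inv_word c\<close>.\<close>
    with cm reduced_nf[OF assms(1)] have "c = []"
      using hd_inv_word[of c] by (auto simp: reduced_append)
    with cm \<open>m = []\<close> assms show False by (simp add: nf_eq_Nil_iff)
  qed
  ultimately show ?thesis using that by blast
qed

text \<open>All inner factors \<open>inv_word c @ c\<close> cancel. In what remains, the seams
  between copies of \<open>m\<close> are harmless because \<open>m\<close> is cyclically reduced,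
  and the two outer seams already occur in \<open>nf x\<close>.\<close>

lemma nf_pow:
  assumes x: "x \<in> carrier G" and nf: "nf x = c @ m @ inv_word c"
    and m: "cyclically_reduced m" "m \<noteq> []" and n: "n > 0"
  shows "nf (x [^] n) = c @ concat (replicate n m) @ inv_word c"
proof -
  let ?w = "c @ concat (replicate n m) @ inv_word c"
  have X: "fst ` set c \<subseteq> X" "fst ` set m \<subseteq> X"
    using nf_letters[OF x] nf by (auto simp: image_Un)
  then have C: "fst ` set c \<subseteq> carrier G" "fst ` set m \<subseteq> carrier G"
    using basis_subset by auto
  have C': "fst ` set (concat (replicate n m)) \<subseteq> carrier G"
    and X': "fst ` set (concat (replicate n m)) \<subseteq> X"
    using C X by (auto simp: set_replicate_conv_if)
  have "x = word_value G c \<otimes> word_value G m \<otimes> inv (word_value G c)"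
    using word_value_nf[OF x] C unfolding nf
    by (simp add: word_value_append word_value_inv_word image_Un m_assoc)
  then have "x [^] n = word_value G c \<otimes> word_value G m [^] n \<otimes> inv (word_value G c)"
    using C by (simp add: conj_nat_pow)
  also have "\<dots> = word_value G ?w"
    using C C' by (simp add: word_value_append word_value_inv_word image_Un m_assoc
        word_value_concat_replicate del: set_concat)
  finally have "x [^] n = word_value G ?w" .
  moreover have "reduced ?w"
    using reduced_nf[OF x] m n reduced_concat_replicate[OF m(1), of n]
      hd_concat_replicate[OF n m(2)] last_concat_replicate[OF n m(2)]
    unfolding nf by (auto simp: reduced_append)
  moreover have "fst ` set ?w \<subseteq> X"
    using X X' unfolding set_append image_Un fst_set_inv_word by blast
  ultimately show ?thesis
    using nf_word_value[of ?w] by simp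
qed

text \<open>The normal form of a positive power still contains the nonempty core
  \<open>m\<close>.\<close>

lemma torsion_free:
  assumes "x \<in> carrier G" "x [^] (n::nat) = \<one>" "n > 0"
  shows "x = \<one>"
proof (rule ccontr)
  assume "x \<noteq> \<one>"
  with assms(1) obtain c m where
    cm: "nf x = c @ m @ inv_word c" "cyclically_reduced m" "m \<noteq> []"
    by (rule obtain_cyclic_reduction)
  then have "nf (x [^] n) \<noteq> []"
    using nf_pow[OF assms(1) cm assms(3)] assms(3) by simp
  with assms(2) show False by simp
qed

lemma int_pow_inject:
  assumes "x \<in> carrier G" "x \<noteq> \<one>" "x [^] (i::int) = x [^] (j::int)"
  shows "i = j"
proof (rule ccontr)
  assume "i \<noteq> j"
  have "x [^] (i - j) = \<one>" "x [^] (j - i) = \<one>"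
    using assms by (simp_all add: int_pow_diff)
  then have "x [^] nat \<bar>i - j\<bar> = \<one>"
    by (cases "i \<ge> j") (auto simp: int_pow_int[symmetric] abs_if)
  with assms(1,2) \<open>i \<noteq> j\<close> torsion_free[of x "nat \<bar>i - j\<bar>"] show False by simp
qed

text \<open>A root of a cyclically reduced element involves no conjugation: a nontrivial conjugator
  would survive in the power.\<close>

lemma nf_root:
  assumes x: "x \<in> carrier G" and n: "n > 0" and cyc: "cyclically_reduced (nf (x [^] n))"
  shows "nf (x [^] n) = concat (replicate n (nf x))"
proof (cases "x = \<one>")
  case False
  then obtain c m where
    cm: "nf x = c @ m @ inv_word c" "cyclically_reduced m" "m \<noteq> []"
    using obtain_cyclic_reduction[OF x] by metis
  have pow: "nf (x [^] n) = c @ concat (replicate n m) @ inv_word c"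
    using nf_pow[OF x cm n] .
  have "c = []"
  proof (rule ccontr)
    assume "c \<noteq> []"
    then have "hd (nf (x [^] n)) = hd c" "last (nf (x [^] n)) = flip (hd c)"
      unfolding pow by (auto simp: last_inv_word)
    with cyc \<open>c \<noteq> []\<close> pow show False by (auto simp: cyclically_reduced_iff)
  qed
  with pow cm show ?thesis by simp
qed simp

lemma unique_roots_cyclically_reduced:
  assumes "x \<in> carrier G" "y \<in> carrier G" "n > 0" "x [^] (n::nat) = y [^] n"
    and "cyclically_reduced (nf (x [^] n))"
  shows "x = y"
proof -
  obtain k where k: "n = Suc k" using assms(3) by (cases n) auto
  have eq: "concat (replicate n (nf x)) = concat (replicate n (nf y))"
    using nf_root[of x n] nf_root[of y n] assms by simp
  then have "length (concat (replicate n (nf x))) = length (concat (replicate n (nf y)))"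
    by simp
  with \<open>n > 0\<close> have "length (nf x) = length (nf y)"
    by (simp add: length_concat sum_list_replicate)
  \<comment> \<open>As the blocks have equal length, the first blocks of the two equal words
    coincide.\<close>
  with eq have "nf x = nf y" unfolding k by simp
  with assms(1,2) show ?thesis by (simp add: nf_eq_iff)
qed

lemma obtain_cyclically_reduced_conj:
  assumes "w \<in> carrier G"
  obtains c v where "c \<in> carrier G" "v \<in> carrier G" "w = c \<otimes> v \<otimes> inv c"
    "cyclically_reduced (nf v)"
proof -
  obtain c m where cm: "nf w = c @ m @ inv_word c" "cyclically_reduced m"
    using cyclic_reduction[OF reduced_nf[OF assms]] .
  then have X: "fst ` set c \<subseteq> X" "fst ` set m \<subseteq> X"
    using nf_letters[OF assms] by (auto simp: image_Un)
  then have C: "fst ` set c \<subseteq> carrier G" "fst ` set m \<subseteq> carrier G"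
    using basis_subset by auto
  have "w = word_value G c \<otimes> word_value G m \<otimes> inv (word_value G c)"
    using word_value_nf[OF assms] C unfolding cm
    by (simp add: word_value_append word_value_inv_word image_Un m_assoc)
  moreover have "nf (word_value G m) = m"
    using X cm by (intro nf_word_value) (auto simp: cyclically_reduced_iff)
  ultimately show ?thesis
    using that[of "word_value G c" "word_value G m"] C cm by simp
qed

text \<open>Conjugating by \<open>inv c\<close> makes the common power cyclically reduced, which
  reduces the claim to the previous case.\<close>

lemma unique_roots:
  assumes x: "x \<in> carrier G" and y: "y \<in> carrier G" and n: "n > 0" and eq: "x [^] (n::nat) = y [^] n"
  shows "x = y"
proof -
  obtain c v where c: "c \<in> carrier G" and v: "v \<in> carrier G"
    and w: "x [^] n = c \<otimes> v \<otimes> inv c" and cyc: "cyclically_reduced (nf v)"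
    using obtain_cyclically_reduced_conj[of "x [^] n"] x by auto
  have *: "(inv c \<otimes> z \<otimes> c) [^] n = v" if "z \<in> carrier G" "z [^] n = x [^] n" for z
  proof -
    have "(inv c \<otimes> z \<otimes> c) [^] n = inv c \<otimes> (c \<otimes> v \<otimes> inv c) \<otimes> c"
      using conj_nat_pow[of "inv c" z n] c that w by simp
    also have "\<dots> = v"
      using conj_conj_inv[of "inv c" v] c v by simp
    finally show ?thesis .
  qed
  have "inv c \<otimes> x \<otimes> c = inv c \<otimes> y \<otimes> c"
  proof (rule unique_roots_cyclically_reduced[OF _ _ n])
    show "(inv c \<otimes> x \<otimes> c) [^] n = (inv c \<otimes> y \<otimes> c) [^] n"
      using *[OF x refl] *[OF y eq[symmetric]] by (rule trans[OF _ sym])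
    show "cyclically_reduced (nf ((inv c \<otimes> x \<otimes> c) [^] n))"
      unfolding *[OF x refl] by (rule cyc)
  qed (use x y c in simp_all)
  then have "c \<otimes> (inv c \<otimes> x \<otimes> c) \<otimes> inv c = c \<otimes> (inv c \<otimes> y \<otimes> c) \<otimes> inv c"
    by (rule arg_cong)
  then show ?thesis
    unfolding conj_conj_inv[OF c x] conj_conj_inv[OF c y] .
qed

lemma unique_roots_int:
  assumes "x \<in> carrier G" "y \<in> carrier G" "n \<noteq> 0" "x [^] (n::int) = y [^] n"
  shows "x = y"
proof (cases n)
  case (nonneg m)
  with assms show ?thesis
    using unique_roots[of x y m] by (simp only: int_pow_int)
next
  case (neg m)
  have "inv (x [^] Suc m) = inv (y [^] Suc m)"
    using assms(1,2,4) unfolding neg by (simp only: int_pow_neg_int)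
  then have "x [^] Suc m = y [^] Suc m"
    by (rule inj_onD[OF inv_inj]) (simp_all add: assms(1,2))
  then show ?thesis
    using unique_roots[OF assms(1,2), of "Suc m"] by simp
qed

text \<open>Without cancellation the normal forms of the two products are concatenations, so
  \<open>nf g\<close> and \<open>nf w\<close> commute as words; commuting words are powers of a
  common word.\<close>

lemma common_root_of_reduced_products:
  assumes g: "g \<in> carrier G" and w: "w \<in> carrier G" and comm: "g \<otimes> w = w \<otimes> g"
    and red: "reduced (nf g @ nf w)" "reduced (nf w @ nf g)"
  shows "\<exists>z\<in>carrier G. \<exists>(a::int) (b::int). g = z [^] a \<and> w = z [^] b"
proof (cases "nf g = [] \<and> nf w = []")
  case True
  with g w show ?thesis by (auto simp: nf_eq_Nil_iff intro!: bexI[of _ \<one>])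
next
  case False
  have "nf (g \<otimes> w) = nf g @ nf w" "nf (w \<otimes> g) = nf w @ nf g"
    using nf_word_value[of "nf g @ nf w"] nf_word_value[of "nf w @ nf g"]
      nf_letters[OF g] nf_letters[OF w] red g w
    by (simp_all add: image_Un mult_eq_word_value)
  with comm have "nf g @ nf w = nf w @ nf g" by simp
  then obtain m n zs where zs: "concat (replicate m zs) = nf g" "concat (replicate n zs) = nf w"
    using comm_append_are_replicate by blast
  \<comment> \<open>A positive exponent makes \<open>zs\<close> a factor of \<open>nf g\<close> or
    \<open>nf w\<close>, so its letters lie in the carrier. If both exponents were zero, nothing
    would be known about \<open>zs\<close>, hence the separate first case.\<close>
  with False have "m > 0 \<or> n > 0" by (cases "m = 0"; cases "n = 0") auto
  then have "set zs \<subseteq> set (nf g) \<union> set (nf w)"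
    unfolding zs[symmetric] by (auto simp: set_replicate_conv_if)
  then have C: "fst ` set zs \<subseteq> carrier G"
    using nf_letters_carrier[OF g] nf_letters_carrier[OF w] by blast
  have "g = word_value G zs [^] int m" "w = word_value G zs [^] int n"
    using word_value_concat_replicate[OF C] zs g w word_value_nf
    by (metis int_pow_int)+
  with C show ?thesis using word_value_closed by blast
qed

text \<open>Both products are the same element, so comparing lengths shows that if one concatenation
  is reduced, so is the other. If neither is, \<open>g\<close> cancels against \<open>w\<close> on
  both sides; as the ends of \<open>w\<close> do not cancel each other, \<open>g\<close> then does
  not cancel against \<open>inv w\<close> on either side, and \<open>inv w\<close> can replace
  \<open>w\<close>.\<close>

lemma common_root_cyclically_reduced:
  assumes g: "g \<in> carrier G" and w: "w \<in> carrier G" "cyclically_reduced (nf w)"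
    and comm: "g \<otimes> w = w \<otimes> g"
  shows "\<exists>z\<in>carrier G. \<exists>(a::int) (b::int). g = z [^] a \<and> w = z [^] b"
proof -
  have len: "reduced (nf x @ nf y)"
    if "x \<in> carrier G" "y \<in> carrier G" "x \<otimes> y = y \<otimes> x" "reduced (nf y @ nf x)" for x y
  proof (rule ccontr)
    assume "\<not> reduced (nf x @ nf y)"
    then have "length (nf (x \<otimes> y)) < length (nf x @ nf y)"
      using length_nf_less[of "nf x @ nf y"] nf_letters[of x] nf_letters[of y] that
      by (simp add: mult_eq_word_value image_Un)
    moreover have "nf (y \<otimes> x) = nf y @ nf x"
      using nf_word_value[of "nf y @ nf x"] nf_letters[of x] nf_letters[of y] that
      by (simp add: image_Un mult_eq_word_value)
    ultimately show False using that(3) by simp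
  qed
  show ?thesis
  proof (cases "reduced (nf g @ nf w)")
    case True
    with len[of w g] show ?thesis
      using common_root_of_reduced_products[OF g w(1) comm] g w comm by simp
  next
    case False
    with len[of g w] g w comm have False': "\<not> reduced (nf w @ nf g)" by auto
    have ne: "nf g \<noteq> []" "nf w \<noteq> []" and 1: "hd (nf w) = flip (last (nf g))"
      using False reduced_nf[OF g] reduced_nf[OF w(1)] by (auto simp: reduced_append)
    have 2: "hd (nf g) = flip (last (nf w))"
      using False' reduced_nf[OF g] reduced_nf[OF w(1)] by (auto simp: reduced_append)
    have cyc: "hd (nf w) \<noteq> flip (last (nf w))"
      using w(2) ne by (auto simp: cyclically_reduced_iff)
    have "reduced (nf g @ nf (inv w))" "reduced (nf (inv w) @ nf g)"
      using reduced_nf[OF g] reduced_nf[OF w(1)] 1 2 cyc ne w(1)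
      by (auto simp: reduced_append nf_inv hd_inv_word last_inv_word)
    then obtain z a b where z: "z \<in> carrier G" "g = z [^] (a::int)" "inv w = z [^] (b::int)"
      using common_root_of_reduced_products[of g "inv w"] g w inv_commute[OF g w(1) comm] by auto
    then have "w = z [^] (- b)"
      using w by (metis int_pow_neg inv_inv)
    with z show ?thesis by blast
  qed
qed

lemma common_root:
  assumes g: "g \<in> carrier G" and w: "w \<in> carrier G" and comm: "g \<otimes> w = w \<otimes> g"
  shows "\<exists>z\<in>carrier G. \<exists>(a::int) (b::int). g = z [^] a \<and> w = z [^] b"
proof -
  obtain c v where c: "c \<in> carrier G" and v: "v \<in> carrier G" "w = c \<otimes> v \<otimes> inv c"
    and cyc: "cyclically_reduced (nf v)"
    using obtain_cyclically_reduced_conj[OF w] .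
  let ?k = "\<lambda>x. inv c \<otimes> x \<otimes> c"
  have k: "?k (x \<otimes> y) = ?k x \<otimes> ?k y" if "x \<in> carrier G" "y \<in> carrier G" for x y
    using conj_hom[of "inv c"] c that by (simp add: hom_def)
  have kw: "?k w = v"
    using conj_conj_inv[of "inv c" v] c v by simp
  have "?k g \<otimes> v = v \<otimes> ?k g"
    using k[OF g w] k[OF w g] comm kw by simp
  then obtain z a b where z: "z \<in> carrier G" "?k g = z [^] (a::int)" "v = z [^] (b::int)"
    using common_root_cyclically_reduced[of "?k g" v] c g v cyc by auto
  have "g = (c \<otimes> z \<otimes> inv c) [^] a" "w = (c \<otimes> z \<otimes> inv c) [^] b"
    using conj_conj_inv[OF c g] v z c by (simp_all add: conj_int_pow)
  with z c show ?thesis by (intro bexI[of _ "c \<otimes> z \<otimes> inv c"]) auto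
qed

text \<open>A common root of \<open>x\<close> and \<open>w\<close> gives
  \<open>x ^ b = w ^ a\<close> with \<open>b\<close> nonzero. Conjugation by \<open>y\<close> fixes
  \<open>w\<close>, hence \<open>x ^ b\<close>, and hence \<open>x\<close> by uniqueness of
  roots.\<close>

lemma commute_trans:
  assumes x: "x \<in> carrier G" and y: "y \<in> carrier G" and w: "w \<in> carrier G" "w \<noteq> \<one>"
    and xw: "x \<otimes> w = w \<otimes> x" and yw: "y \<otimes> w = w \<otimes> y"
  shows "x \<otimes> y = y \<otimes> x"
proof -
  obtain z a b where z: "z \<in> carrier G" "x = z [^] (a::int)" "w = z [^] (b::int)"
    using common_root[OF x w(1) xw] by blast
  with w(2) have b: "b \<noteq> 0" by auto
  have xb: "x [^] b = w [^] a"
    using z int_pow_pow_commute by simp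
  have "(y \<otimes> x \<otimes> inv y) [^] b = y \<otimes> w [^] a \<otimes> inv y"
    using conj_int_pow[OF y x] xb by simp
  also have "\<dots> = (y \<otimes> w \<otimes> inv y) [^] a"
    using conj_int_pow[OF y w(1)] by simp
  also have "y \<otimes> w \<otimes> inv y = w"
    using yw y w by (simp add: m_assoc)
  finally have "(y \<otimes> x \<otimes> inv y) [^] b = x [^] b" using xb by simp
  then have "y \<otimes> x \<otimes> inv y = x"
    using unique_roots_int[OF _ x b] x y by simp
  then show ?thesis
    using x y inv_solve_right'[of x "y \<otimes> x" y] by simp
qed

section \<open>Maximal exponents and roots\<close>

lemma exponent_bounded:
  assumes w: "w \<in> carrier G" "w \<noteq> \<one>"
  shows "\<exists>B. \<forall>r. \<forall>v\<in>carrier G. w = v [^] (r::nat) \<longrightarrow> r \<le> B"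
proof -
  obtain c t where c: "c \<in> carrier G" and t: "t \<in> carrier G" "w = c \<otimes> t \<otimes> inv c"
    and cyc: "cyclically_reduced (nf t)"
    using obtain_cyclically_reduced_conj[OF w(1)] .
  \<comment> \<open>After conjugation to a cyclically reduced \<open>t\<close>, the word
    \<open>nf t\<close> consists of \<open>r\<close> copies of the nonempty normal form of the
    conjugated root.\<close>
  have "r \<le> length (nf t)" if v: "v \<in> carrier G" "w = v [^] r" for r :: nat and v
  proof (cases "r = 0")
    case False
    let ?v = "inv c \<otimes> v \<otimes> c"
    have "?v [^] r = inv c \<otimes> (c \<otimes> t \<otimes> inv c) \<otimes> c"
      using conj_nat_pow[of "inv c" v r] c v t by simp
    then have r: "?v [^] r = t"
      using conj_conj_inv[of "inv c" t] c t by simp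
    have "?v \<noteq> \<one>"
    proof
      assume "?v = \<one>"
      with r have "t = \<one>" by simp
      with t c w(2) show False by simp
    qed
    moreover have "nf t = concat (replicate r (nf ?v))"
      using nf_root[of ?v r] r cyc False c v by simp
    ultimately have "length (nf t) \<ge> r * 1"
      using c v by (simp add: length_concat sum_list_replicate nf_eq_Nil_iff Suc_le_eq)
    then show ?thesis by simp
  qed simp
  then show ?thesis by blast
qed

text \<open>The bound on exponents guarantees that the \<open>GREATEST\<close> in
  \<open>elem_exp\<close> is attained.\<close>

lemma
  assumes w: "w \<in> carrier G" "w \<noteq> \<one>"
  shows elem_exp_pos: "elem_exp G w \<ge> 1"
    and elem_exp_root: "\<exists>v\<in>carrier G. w = v [^] elem_exp G w"
    and elem_exp_max: "r \<ge> 1 \<Longrightarrow> v \<in> carrier G \<Longrightarrow> w = v [^] r \<Longrightarrow> r \<le> elem_exp G w"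
proof -
  let ?P = "\<lambda>r::nat. r \<ge> 1 \<and> (\<exists>v\<in>carrier G. w = v [^] r)"
  obtain B where B': "r \<le> B" if "?P r" for r
    using exponent_bounded[OF w] by blast
  have "?P 1" using w by auto
  then have *: "?P (elem_exp G w)"
    unfolding elem_exp_def by (rule GreatestI_nat[of ?P 1 B]) (use B' in auto)
  then show "elem_exp G w \<ge> 1" "\<exists>v\<in>carrier G. w = v [^] elem_exp G w" by auto
  show "r \<le> elem_exp G w" if "r \<ge> 1" "v \<in> carrier G" "w = v [^] r"
    unfolding elem_exp_def by (rule Greatest_le_nat[of ?P r B]) (use B' that in auto)
qed

lemma
  assumes w: "w \<in> carrier G" "w \<noteq> \<one>"
  shows elem_root_closed: "elem_root G w \<in> carrier G"
    and elem_root_pow: "elem_root G w [^] elem_exp G w = w"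
proof -
  have "\<exists>!u. u \<in> carrier G \<and> w = u [^] elem_exp G w"
    using elem_exp_root[OF w] elem_exp_pos[OF w] unique_roots[of _ _ "elem_exp G w"] by fastforce
  from theI'[OF this] show "elem_root G w \<in> carrier G" "elem_root G w [^] elem_exp G w = w"
    unfolding elem_root_def by auto
qed

lemma elem_root_neq_one:
  assumes "w \<in> carrier G" "w \<noteq> \<one>"
  shows "elem_root G w \<noteq> \<one>"
  using elem_root_pow[OF assms] assms(2) by auto

text \<open>Both \<open>g\<close> and the root \<open>u\<close> commute with \<open>w\<close>, hence
  with each other, so they are powers of some \<open>z\<close>, say \<open>u = z ^ b\<close>. Then
  \<open>w = z ^ (b * e)\<close>, and maximality of \<open>e\<close> forces \<open>b\<close> to be 1
  or -1.\<close>

lemma commute_imp_power_of_root: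
  assumes w: "w \<in> carrier G" "w \<noteq> \<one>" and g: "g \<in> carrier G" "g \<otimes> w = w \<otimes> g"
  shows "\<exists>k::int. g = elem_root G w [^] k"
proof -
  let ?u = "elem_root G w" and ?e = "elem_exp G w"
  have u: "?u \<in> carrier G" using elem_root_closed[OF w] .
  have we: "w = ?u [^] int ?e" using elem_root_pow[OF w] by (simp add: int_pow_int)
  have "?u \<otimes> w = w \<otimes> ?u"
    using int_pow_commute[OF u, of 1 "int ?e"] u we by simp
  then have "g \<otimes> ?u = ?u \<otimes> g"
    using commute_trans[OF g(1) u w g(2)] by simp
  then obtain z a b where z: "z \<in> carrier G" "g = z [^] (a::int)" "?u = z [^] (b::int)"
    using common_root[OF g(1) u] by blast
  have b: "b \<noteq> 0" using z elem_root_neq_one[OF w] by auto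
  have wz: "w = z [^] (b * int ?e)"
    using we z by (simp add: int_pow_pow)
  \<comment> \<open>\<open>elem_exp_max\<close> speaks of natural exponents; a negative
    \<open>b\<close> is absorbed by inverting \<open>z\<close>.\<close>
  then have "w = (if b > 0 then z else inv z) [^] (nat \<bar>b\<bar> * ?e)"
    using z(1) b
    by (auto simp: int_pow_int[symmetric] int_pow_inv int_pow_neg[symmetric])
  moreover have "nat \<bar>b\<bar> * ?e \<ge> 1"
    using b elem_exp_pos[OF w] by (simp add: Suc_le_eq)
  ultimately have "nat \<bar>b\<bar> * ?e \<le> ?e"
    using elem_exp_max[OF w, of "nat \<bar>b\<bar> * ?e" "if b > 0 then z else inv z"] z(1) by simp
  with elem_exp_pos[OF w] have "nat \<bar>b\<bar> \<le> 1" by simp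
  with b have "b = 1 \<or> b = - 1" by linarith
  \<comment> \<open>This treats both signs at once: \<open>a = b * (b * a)\<close>, and
    \<open>z ^ b\<close> is \<open>u\<close>.\<close>
  then have "b * b = 1" by auto
  then have "g = z [^] (b * (b * a))" using z by (simp add: mult.assoc[symmetric])
  also have "\<dots> = ?u [^] (b * a)" using z by (simp add: int_pow_pow)
  finally show ?thesis by blast
qed

end

section \<open>Unitriangular matrix groups\<close>

definition upper_positions :: "nat \<Rightarrow> (nat \<times> nat) set" where
  "upper_positions n = {(i, j). i < j \<and> j \<le> n}"

text \<open>Upper unitriangular matrices of size \<open>n + 1\<close> over \<open>\<int>/m\<close>. Only the entries strictly above
  the diagonal are stored, so that a carrier over \<open>\<int>/p\<^sup>k\<close> visibly has \<open>p\<close>-power order.\<close>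

definition unitriangular :: "nat \<Rightarrow> int \<Rightarrow> (nat \<times> nat \<Rightarrow> int) monoid" where
  "unitriangular n m = \<lparr>
     carrier = upper_positions n \<rightarrow>\<^sub>E {0..<m},
     monoid.mult = (\<lambda>A B. \<lambda>(i, j)\<in>upper_positions n.
       (A (i, j) + B (i, j) + (\<Sum>l\<in>{i<..<j}. A (i, l) * B (l, j))) mod m),
     one = (\<lambda>x\<in>upper_positions n. 0)\<rparr>"

lemma finite_upper_positions: "finite (upper_positions n)"
  by (rule finite_subset[of _ "{..n} \<times> {..n}"]) (auto simp: upper_positions_def)

lemma finite_unitriangular: "finite (carrier (unitriangular n m))"
  by (simp add: unitriangular_def finite_PiE finite_upper_positions)

lemma unitriangular_mult:
  "i < j \<Longrightarrow> j \<le> n \<Longrightarrow> (A \<otimes>\<^bsub>unitriangular n m\<^esub> B) (i, j) =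
     (A (i, j) + B (i, j) + (\<Sum>l\<in>{i<..<j}. A (i, l) * B (l, j))) mod m"
  by (simp add: unitriangular_def upper_positions_def)

lemma unitriangular_one: "i < j \<Longrightarrow> j \<le> n \<Longrightarrow> \<one>\<^bsub>unitriangular n m\<^esub> (i, j) = 0"
  by (simp add: unitriangular_def upper_positions_def)

lemma unitriangular_mult_closed:
  "m > 0 \<Longrightarrow> A \<otimes>\<^bsub>unitriangular n m\<^esub> B \<in> carrier (unitriangular n m)"
  by (auto simp: unitriangular_def)

lemma unitriangular_one_closed: "m > 0 \<Longrightarrow> \<one>\<^bsub>unitriangular n m\<^esub> \<in> carrier (unitriangular n m)"
  by (auto simp: unitriangular_def)

lemma unitriangular_entry:
  "A \<in> carrier (unitriangular n m) \<Longrightarrow> i < j \<Longrightarrow> j \<le> n \<Longrightarrow> A (i, j) mod m = A (i, j)"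
  by (auto simp: unitriangular_def upper_positions_def dest!: PiE_mem[of _ _ _ "(i, j)"])

lemma unitriangular_eqI:
  assumes "A \<in> carrier (unitriangular n m)" "B \<in> carrier (unitriangular n m)"
    and "\<And>i j. i < j \<Longrightarrow> j \<le> n \<Longrightarrow> A (i, j) = B (i, j)"
  shows "A = B"
proof (rule PiE_ext)
  show "A \<in> upper_positions n \<rightarrow>\<^sub>E {0..<m}" "B \<in> upper_positions n \<rightarrow>\<^sub>E {0..<m}"
    using assms(1,2) by (simp_all add: unitriangular_def)
  show "A x = B x" if "x \<in> upper_positions n" for x
    using that assms(3) by (auto simp: upper_positions_def)
qed

lemma group_unitriangular:
  assumes m: "m > 0"
  shows "group (unitriangular n m)"
proof (rule groupI)
  let ?U = "unitriangular n m"
  show closed: "A \<otimes>\<^bsub>?U\<^esub> B \<in> carrier ?U" for A B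
    using m by (rule unitriangular_mult_closed)
  show one: "\<one>\<^bsub>?U\<^esub> \<in> carrier ?U"
    using m by (rule unitriangular_one_closed)
  show one_l: "\<one>\<^bsub>?U\<^esub> \<otimes>\<^bsub>?U\<^esub> A = A" if "A \<in> carrier ?U" for A
  proof (rule unitriangular_eqI[OF closed that])
    fix i j assume ij: "i < j" "j \<le> n"
    then have "(\<Sum>l\<in>{i<..<j}. \<one>\<^bsub>?U\<^esub> (i, l) * A (l, j)) = 0"
      by (intro sum.neutral) (auto simp: unitriangular_one)
    with ij that show "(\<one>\<^bsub>?U\<^esub> \<otimes>\<^bsub>?U\<^esub> A) (i, j) = A (i, j)"
      by (simp add: unitriangular_mult unitriangular_one unitriangular_entry)
  qed
  show "A \<otimes>\<^bsub>?U\<^esub> B \<otimes>\<^bsub>?U\<^esub> C = A \<otimes>\<^bsub>?U\<^esub> (B \<otimes>\<^bsub>?U\<^esub> C)" for A B C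
  proof (rule unitriangular_eqI[OF closed closed])
    fix i j assume ij: "i < j" "j \<le> n"
    let ?S = "{i<..<j}"
    let ?p = "\<lambda>i j. A (i, j) + B (i, j) + (\<Sum>k\<in>{i<..<j}. A (i, k) * B (k, j))"
    let ?q = "\<lambda>i j. B (i, j) + C (i, j) + (\<Sum>k\<in>{i<..<j}. B (i, k) * C (k, j))"
    have "(A \<otimes>\<^bsub>?U\<^esub> B \<otimes>\<^bsub>?U\<^esub> C) (i, j) =
        (?p i j mod m + C (i, j) + (\<Sum>l\<in>?S. (?p i l mod m) * C (l, j))) mod m"
      using ij by (auto simp: unitriangular_mult intro!: arg_cong[of _ _ "\<lambda>x. (_ + x) mod m"] sum.cong)
    also have "\<dots> = (?p i j + C (i, j) + (\<Sum>l\<in>?S. ?p i l * C (l, j))) mod m"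
      unfolding cong_def[symmetric]
      by (intro cong_add cong_sum cong_mult cong_refl) (simp_all add: cong_def)
    also have "(\<Sum>l\<in>?S. ?p i l * C (l, j)) = (\<Sum>l\<in>?S. A (i, l) * C (l, j)) +
        (\<Sum>l\<in>?S. B (i, l) * C (l, j)) + (\<Sum>l\<in>?S. \<Sum>k\<in>{k\<in>?S. k < l}. A (i, k) * B (k, l) * C (l, j))"
      by (auto simp: sum.distrib sum_distrib_right distrib_right intro!: sum.cong)
    \<comment> \<open>Both bracketings sum over the chains \<open>i < k < l < j\<close>, one with
      \<open>l\<close> outermost and the other with \<open>k\<close>.\<close>
    also have "(\<Sum>l\<in>?S. \<Sum>k\<in>{k\<in>?S. k < l}. A (i, k) * B (k, l) * C (l, j)) =
        (\<Sum>k\<in>?S. \<Sum>l\<in>{l\<in>?S. k < l}. A (i, k) * B (k, l) * C (l, j))"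
      by (rule sum.swap_restrict) auto
    also have "?p i j + C (i, j) + ((\<Sum>l\<in>?S. A (i, l) * C (l, j)) +
        (\<Sum>l\<in>?S. B (i, l) * C (l, j)) +
        (\<Sum>k\<in>?S. \<Sum>l\<in>{l\<in>?S. k < l}. A (i, k) * B (k, l) * C (l, j))) =
        A (i, j) + ?q i j + (\<Sum>k\<in>?S. A (i, k) * ?q k j)"
      by (auto simp: sum.distrib sum_distrib_left distrib_left mult.assoc intro!: sum.cong)
    also have "\<dots> mod m = (A (i, j) + ?q i j mod m + (\<Sum>k\<in>?S. A (i, k) * (?q k j mod m))) mod m"
      unfolding cong_def[symmetric]
      by (intro cong_add cong_sum cong_mult cong_refl) (simp_all add: cong_def)
    also have "\<dots> = (A \<otimes>\<^bsub>?U\<^esub> (B \<otimes>\<^bsub>?U\<^esub> C)) (i, j)"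
      using ij by (auto simp: unitriangular_mult intro!: arg_cong[of _ _ "\<lambda>x. (_ + x) mod m"] sum.cong)
    finally show "(A \<otimes>\<^bsub>?U\<^esub> B \<otimes>\<^bsub>?U\<^esub> C) (i, j) = (A \<otimes>\<^bsub>?U\<^esub> (B \<otimes>\<^bsub>?U\<^esub> C)) (i, j)" .
  qed
  text \<open>Multiplication from the right is injective, hence surjective by finiteness.\<close>
  show "\<exists>B\<in>carrier ?U. B \<otimes>\<^bsub>?U\<^esub> A = \<one>\<^bsub>?U\<^esub>" if A: "A \<in> carrier ?U" for A
  proof -
    have "inj_on (\<lambda>B. B \<otimes>\<^bsub>?U\<^esub> A) (carrier ?U)"
    proof (rule inj_onI)
      fix B C assume B: "B \<in> carrier ?U" and C: "C \<in> carrier ?U"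
        and eq: "B \<otimes>\<^bsub>?U\<^esub> A = C \<otimes>\<^bsub>?U\<^esub> A"
      \<comment> \<open>Apart from \<open>B (i, j)\<close> itself, the entry \<open>(i, j)\<close>
        of the product involves only entries of \<open>B\<close> in row \<open>i\<close> and earlier
        columns, so columns are compared by induction.\<close>
      have "B (i, j) = C (i, j)" if "i < j" "j \<le> n" for i j
        using that
      proof (induction j rule: less_induct)
        case (less j)
        let ?s = "A (i, j) + (\<Sum>l\<in>{i<..<j}. C (i, l) * A (l, j))"
        have "(\<Sum>l\<in>{i<..<j}. B (i, l) * A (l, j)) = (\<Sum>l\<in>{i<..<j}. C (i, l) * A (l, j))"
          using less by (intro sum.cong) auto
        with fun_cong[OF eq, of "(i, j)"] less.prems
        have "[B (i, j) + ?s = C (i, j) + ?s] (mod m)"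
          by (simp add: unitriangular_mult cong_def add.assoc)
        then have "[B (i, j) = C (i, j)] (mod m)"
          by (simp only: cong_add_rcancel)
        then show ?case
          using unitriangular_entry[OF B less.prems] unitriangular_entry[OF C less.prems]
          by (simp add: cong_def)
      qed
      then show "B = C" using B C by (intro unitriangular_eqI)
    qed
    then have "(\<lambda>B. B \<otimes>\<^bsub>?U\<^esub> A) ` carrier ?U = carrier ?U"
      using closed finite_unitriangular by (intro endo_inj_surj) auto
    with one show ?thesis by (metis imageE)
  qed
qed

lemma order_unitriangular:
  "order (unitriangular n (int m)) = m ^ card (upper_positions n)"
  by (simp add: order_def unitriangular_def card_PiE finite_upper_positions)

text \<open>The matrix \<open>1 + a * N\<close> modulo \<open>m\<close>, where \<open>N\<close> has
  ones exactly at the positions \<open>(i, Suc i)\<close> with \<open>P i\<close>.\<close>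

definition superdiagonal :: "nat \<Rightarrow> int \<Rightarrow> (nat \<Rightarrow> bool) \<Rightarrow> int \<Rightarrow> nat \<times> nat \<Rightarrow> int" where
  "superdiagonal n m P a =
     (\<lambda>(i, j)\<in>upper_positions n. if j = Suc i \<and> P i then a mod m else 0)"

lemma superdiagonal_entry:
  "i < j \<Longrightarrow> j \<le> n \<Longrightarrow> superdiagonal n m P a (i, j) = (if j = Suc i \<and> P i then a mod m else 0)"
  by (simp add: superdiagonal_def upper_positions_def)

lemma superdiagonal_closed: "m > 0 \<Longrightarrow> superdiagonal n m P a \<in> carrier (unitriangular n m)"
  by (auto simp: superdiagonal_def unitriangular_def)

lemma superdiagonal_0: "superdiagonal n m P 0 = \<one>\<^bsub>unitriangular n m\<^esub>"
  by (auto simp: superdiagonal_def unitriangular_def fun_eq_iff restrict_def)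

text \<open>If \<open>P\<close> never holds at two consecutive indices, then
  \<open>N * N = 0\<close>, so the parameters \<open>a\<close> and \<open>b\<close> simply
  add.\<close>

lemma superdiagonal_mult:
  assumes m: "m > 0" and P: "\<And>i. Suc i < n \<Longrightarrow> \<not> (P i \<and> P (Suc i))"
  shows "superdiagonal n m P a \<otimes>\<^bsub>unitriangular n m\<^esub> superdiagonal n m P b = superdiagonal n m P (a + b)"
proof (rule unitriangular_eqI)
  fix i j assume ij: "i < j" "j \<le> n"
  have "(\<Sum>l\<in>{i<..<j}. superdiagonal n m P a (i, l) * superdiagonal n m P b (l, j)) = 0"
    using ij P[of i] by (intro sum.neutral) (auto simp: superdiagonal_entry)
  with ij show "(superdiagonal n m P a \<otimes>\<^bsub>unitriangular n m\<^esub> superdiagonal n m P b) (i, j) =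
      superdiagonal n m P (a + b) (i, j)"
    by (auto simp: unitriangular_mult superdiagonal_entry mod_add_eq)
qed (use m in \<open>auto intro: superdiagonal_closed unitriangular_mult_closed\<close>)

lemma superdiagonal_int_pow:
  assumes m: "m > 0" and P: "\<And>i. Suc i < n \<Longrightarrow> \<not> (P i \<and> P (Suc i))"
  shows "superdiagonal n m P 1 [^]\<^bsub>unitriangular n m\<^esub> (k::int) = superdiagonal n m P k"
proof -
  interpret U: group "unitriangular n m"
    using m by (rule group_unitriangular)
  have mult: "superdiagonal n m P a \<otimes>\<^bsub>unitriangular n m\<^esub> superdiagonal n m P b =
      superdiagonal n m P (a + b)" for a b
    using m P by (rule superdiagonal_mult)
  have nat: "superdiagonal n m P 1 [^]\<^bsub>unitriangular n m\<^esub> k = superdiagonal n m P (int k)" for k :: nat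
  proof (induction k)
    case 0
    then show ?case by (simp add: superdiagonal_0)
  next
    case (Suc k)
    then show ?case
      by (simp add: mult add.commute)
  qed
  show ?thesis
  proof (cases k)
    case (nonneg l)
    then show ?thesis by (simp only: int_pow_int nat)
  next
    case (neg l)
    have "inv\<^bsub>unitriangular n m\<^esub> (superdiagonal n m P (int (Suc l))) = superdiagonal n m P (- int (Suc l))"
      using m by (intro U.inv_equality)
        (simp_all only: mult superdiagonal_closed superdiagonal_0 ab_left_minus)
    with neg show ?thesis
      using m by (simp only: U.int_pow_neg_int superdiagonal_closed nat)
  qed
qed

text \<open>Each factor moves at most one step to the right, so reaching column \<open>n\<close> from row \<open>t\<close>
  forces the use of all the factors \<open>t, \<dots>, n - 1\<close>.\<close>

lemma superdiagonal_product_entry: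
  fixes e :: "nat \<Rightarrow> int" and m :: int
  assumes "t \<le> n" and Q: "\<And>s. s < n \<Longrightarrow> Q s s"
  defines "R \<equiv> \<lambda>t. foldr (\<lambda>s A. superdiagonal n m (Q s) (e s) \<otimes>\<^bsub>unitriangular n m\<^esub> A)
    [t..<n] \<one>\<^bsub>unitriangular n m\<^esub>"
  shows "(\<forall>i<t. R t (i, n) = 0) \<and> (t < n \<longrightarrow> R t (t, n) = (\<Prod>s\<in>{t..<n}. e s) mod m)"
  using assms(1)
proof (induction t rule: inc_induct)
  case base
  then show ?case by (simp add: R_def unitriangular_one)
next
  case (step t)
  \<comment> \<open>The entry \<open>R (Suc t) (i, n)\<close> vanishes by the induction hypothesis,
    since \<open>i < Suc t\<close>, and in the sum over \<open>l\<close> only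
    \<open>l = Suc i\<close> survives.\<close>
  have R: "R t (i, n) = (superdiagonal n m (Q t) (e t) (i, n) +
      (if Suc i < n then superdiagonal n m (Q t) (e t) (i, Suc i) * R (Suc t) (Suc i, n) else 0)) mod m"
    if "i \<le> t" for i
  proof -
    have "(\<Sum>l\<in>{i<..<n}. superdiagonal n m (Q t) (e t) (i, l) * R (Suc t) (l, n)) =
        (\<Sum>l\<in>{i<..<n}. if l = Suc i then superdiagonal n m (Q t) (e t) (i, Suc i) * R (Suc t) (Suc i, n) else 0)"
      by (intro sum.cong) (auto simp: superdiagonal_entry)
    moreover have "R t = superdiagonal n m (Q t) (e t) \<otimes>\<^bsub>unitriangular n m\<^esub> R (Suc t)"
      using step.hyps by (simp add: R_def upt_conv_Cons)
    ultimately show ?thesis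
      using step that by (simp add: unitriangular_mult sum.delta)
  qed
  have "R t (i, n) = 0" if "i < t" for i
    using R[of i] that step by (simp add: superdiagonal_entry)
  moreover have "R t (t, n) = (\<Prod>s\<in>{t..<n}. e s) mod m"
  proof (cases "Suc t = n")
    case True
    then show ?thesis using R[of t] Q[of t] by (auto simp: superdiagonal_entry)
  next
    case False
    with step.hyps have "Suc t < n" by simp
    then show ?thesis
      using R[of t] Q[of t] step.IH
      by (simp add: superdiagonal_entry prod.atLeast_Suc_lessThan mod_mult_eq)
  qed
  ultimately show ?case by blast
qed

section \<open>Free groups are residually finite p-groups\<close>

text \<open>Letters are merged from the right. The clauses on the first syllable carry the
  induction: reducedness gives neighbouring letters over the same generator the same sign, so
  enlarging a syllable never makes its exponent zero.\<close>

lemma (in group) obtain_syllables: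
  assumes "reduced ls" "ls \<noteq> []" "fst ` set ls \<subseteq> carrier G"
  shows "\<exists>sy :: ('a \<times> int) list. sy \<noteq> [] \<and> (\<forall>s\<in>set sy. fst s \<in> fst ` set ls \<and> snd s \<noteq> 0) \<and>
    successively (\<lambda>s t. fst s \<noteq> fst t) sy \<and> fst (hd sy) = fst (hd ls) \<and>
    (snd (hd sy) > 0 \<longleftrightarrow> snd (hd ls)) \<and>
    word_value G ls = foldr (\<lambda>s g. fst s [^] snd s \<otimes> g) sy \<one>"
  using assms
proof (induction ls rule: induct_list012)
  case (2 l)
  then show ?case
    by (intro exI[of _ "[(fst l, if snd l then 1 else -1)]"])
      (auto simp: letter_value_def int_pow_neg)
next
  case (3 l m ms)
  define d :: int where "d = (if snd l then 1 else - 1)"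
  have l: "letter_value G l = fst l [^] d"
    using "3.prems" by (auto simp: letter_value_def int_pow_neg d_def)
  have red: "reduced (m # ms)" "m \<noteq> flip l"
    using "3.prems" by (auto simp: reduced_Cons)
  with "3.prems" "3.IH"(2) obtain sy :: "('a \<times> int) list" where
    sy: "sy \<noteq> []" "\<forall>s\<in>set sy. fst s \<in> fst ` set (m # ms) \<and> snd s \<noteq> 0"
    "successively (\<lambda>s t. fst s \<noteq> fst t) sy" "fst (hd sy) = fst m" "snd (hd sy) > 0 \<longleftrightarrow> snd m"
    "word_value G (m # ms) = foldr (\<lambda>s g. fst s [^] snd s \<otimes> g) sy \<one>"
    by auto
  have "fst s \<in> carrier G" if "s \<in> set sy" for s
  proof -
    have "fst s \<in> fst ` set (m # ms)" using sy(2) that by blast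
    with "3.prems"(3) show ?thesis by auto
  qed
  then have C: "foldr (\<lambda>s g. fst s [^] snd s \<otimes> g) ss \<one> \<in> carrier G" if "set ss \<subseteq> set sy" for ss
    using that by (induction ss) auto
  have v: "word_value G (l # m # ms) = fst l [^] d \<otimes> foldr (\<lambda>s g. fst s [^] snd s \<otimes> g) sy \<one>"
    using sy(6) by (simp add: l)
  obtain x e sy' where sy': "sy = (x, e) # sy'"
    using sy(1) by (cases sy) auto
  show ?case
  proof (cases "fst l = fst m")
    case True
    with red(2) have "snd l = snd m" by (auto simp: flip_def prod_eq_iff)
    with sy sy' have "e + d \<noteq> 0" "(e + d > 0) = snd l"
      by (auto simp: d_def)
    moreover have "foldr (\<lambda>s g. fst s [^] snd s \<otimes> g) sy' \<one> \<in> carrier G"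
      using sy' by (intro C) auto
    then have "word_value G (l # m # ms) = foldr (\<lambda>s g. fst s [^] snd s \<otimes> g) ((x, e + d) # sy') \<one>"
      using v sy sy' True "3.prems"(3)
      by (simp add: add.commute[of e d] int_pow_mult m_assoc)
    ultimately show ?thesis
      using sy sy' True
      by (intro exI[of _ "(x, e + d) # sy'"]) (auto simp: successively_Cons)
  next
    case False
    with v sy show ?thesis
      by (intro exI[of _ "(fst l, d) # sy"]) (auto simp: successively_Cons d_def)
  qed
qed simp

text \<open>The members of \<open>pgroups\<close> live on \<open>nat\<close>, so a finite
  \<open>p\<close>-group of another type is transported along an injection into
  \<open>nat\<close>.\<close>

lemma pgroups_image:
  assumes "group H" "finite (carrier H)" "order H = p ^ n"
  shows "\<exists>K\<in>pgroups p. \<exists>f. f \<in> hom H K \<and> inj_on f (carrier H)"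
proof -
  obtain f :: "'a \<Rightarrow> nat" where f: "inj_on f (carrier H)"
    using finite_imp_inj_to_nat_seg[OF assms(2)] by blast
  have "image_group f H \<in> pgroups p"
    using group.inj_imp_image_group_is_group[OF assms(1) f] assms(2,3) f
    by (auto simp: pgroups_def order_def image_group_carrier card_image)
  moreover have "f \<in> hom H (image_group f H)"
    using inj_imp_image_group_iso[OF f] by (simp add: iso_def)
  ultimately show ?thesis using f by blast
qed

context based_free_group
begin

lemma residually_p:
  assumes p: "prime p" and g: "g \<in> carrier G" "g \<noteq> \<one>"
  shows "\<exists>H\<in>pgroups p. \<exists>h\<in>hom G H. h g \<noteq> \<one>\<^bsub>H\<^esub>"
proof -
  obtain sy :: "('a \<times> int) list" where sy: "sy \<noteq> []" "\<forall>s\<in>set sy. fst s \<in> fst ` set (nf g) \<and> snd s \<noteq> 0"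
    "successively (\<lambda>s t. fst s \<noteq> fst t) sy"
    "word_value G (nf g) = foldr (\<lambda>s g. fst s [^] snd s \<otimes> g) sy \<one>"
    using obtain_syllables[OF reduced_nf[OF g(1)]] nf_letters_carrier[OF g(1)] g
    by (auto simp: nf_eq_Nil_iff)
  define n where "n = length sy"
  define x where "x = (\<lambda>i. fst (sy ! i))"
  define e where "e = (\<lambda>i. snd (sy ! i))"
  have n: "n > 0" using sy(1) by (simp add: n_def)
  have x: "x i \<in> X" and e: "e i \<noteq> 0" if "i < n" for i
  proof -
    have "sy ! i \<in> set sy" using that by (simp add: n_def)
    with sy(2) nf_letters[OF g(1)] show "x i \<in> X" "e i \<noteq> 0"
      unfolding x_def e_def by blast+
  qed
  have x_neq: "x i \<noteq> x (Suc i)" if "Suc i < n" for i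
    using sy(3) that by (simp add: successively_conv_nth x_def n_def)
  \<comment> \<open>With \<open>k\<close> the absolute value of the product of the exponents,
    \<open>p ^ k > k\<close>, so this nonzero product is not divisible by \<open>m\<close>.\<close>
  define k where "k = nat \<bar>\<Prod>s\<in>{0..<n}. e s\<bar>"
  define m where "m = int (p ^ k)"
  have "k < p ^ k"
    using power_gt_expt[of p k] prime_ge_2_nat[OF p] by simp
  then have "int k < m"
    unfolding m_def of_nat_less_iff .
  then have m: "m > \<bar>\<Prod>s\<in>{0..<n}. e s\<bar>"
    by (simp add: k_def)
  then have m0: "m > 0" by linarith
  let ?U = "unitriangular n m"
  interpret U: group ?U using m0 by (rule group_unitriangular)
  \<comment> \<open>Syllables are numbered from 0, and syllable \<open>i\<close> owns the position
    \<open>(i, Suc i)\<close>. Neighbouring syllables have different generators, so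
    \<open>P y\<close> never holds at consecutive indices.\<close>
  define P where "P = (\<lambda>y i. i < n \<and> x i = y)"
  have P: "\<not> (P y i \<and> P y (Suc i))" for y i
    using x_neq[of i] by (auto simp: P_def)
  define h where "h = extension ?U (\<lambda>y. superdiagonal n m (P y) 1)"
  have h: "h \<in> hom G ?U"
    unfolding h_def using m0 by (intro extension_hom U.is_group) (auto intro: superdiagonal_closed)
  interpret h: group_hom G ?U h
    using h by (simp add: group_hom_def group_hom_axioms_def U.is_group is_group)
  have hx: "h (y [^] a) = superdiagonal n m (P y) a" if "y \<in> X" for y and a :: int
  proof -
    have "h y = superdiagonal n m (P y) 1"
      unfolding h_def using m0 that by (intro extension_basis U.is_group superdiagonal_closed)
    then show ?thesis
      using superdiagonal_int_pow[OF m0, of n "P y" a] P h.hom_int_pow[of y a] that basis_subset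
      by auto
  qed
  have hfold: "foldr (\<lambda>i u. x i [^] e i \<otimes> u) is \<one> \<in> carrier G \<and>
      h (foldr (\<lambda>i u. x i [^] e i \<otimes> u) is \<one>) =
      foldr (\<lambda>i A. superdiagonal n m (P (x i)) (e i) \<otimes>\<^bsub>?U\<^esub> A) is \<one>\<^bsub>?U\<^esub>"
    if "set is \<subseteq> {..<n}" for "is"
    using that
  proof (induction "is")
    case (Cons i "is")
    moreover have "x i \<in> X" "x i \<in> carrier G"
      using Cons.prems x basis_subset by auto
    ultimately show ?case by (simp add: hx)
  qed simp
  have "g = foldr (\<lambda>s g. fst s [^] snd s \<otimes> g) (map ((!) sy) [0..<n]) \<one>"
    using sy(4) g by (simp add: n_def map_nth)
  also have "\<dots> = foldr (\<lambda>i u. x i [^] e i \<otimes> u) [0..<n] \<one>"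
    by (simp add: foldr_map x_def e_def comp_def)
  finally have "h g (0, n) = (\<Prod>s\<in>{0..<n}. e s) mod m"
    using hfold[of "[0..<n]"] n
      superdiagonal_product_entry[of 0 n "\<lambda>s. P (x s)" m e]
    by (simp add: P_def atLeast0LessThan)
  also have "\<dots> \<noteq> 0"
  proof
    assume "(\<Prod>s\<in>{0..<n}. e s) mod m = 0"
    then have "m dvd (\<Prod>s\<in>{0..<n}. e s)" by (rule mod_0_imp_dvd)
    moreover have "(\<Prod>s\<in>{0..<n}. e s) \<noteq> 0" using e by simp
    ultimately have "\<bar>m\<bar> \<le> \<bar>\<Prod>s\<in>{0..<n}. e s\<bar>" by (rule dvd_imp_le_int[rotated])
    with m show False by linarith
  qed
  finally have hg: "h g \<noteq> \<one>\<^bsub>?U\<^esub>"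
    using unitriangular_one[of 0 n n m] n by auto
  have "order ?U = p ^ (k * card (upper_positions n))"
    unfolding m_def power_mult by (rule order_unitriangular)
  from pgroups_image[OF U.is_group finite_unitriangular this]
  obtain K f where K: "K \<in> pgroups p" "f \<in> hom ?U K" "inj_on f (carrier ?U)"
    by blast
  then have "group K" by (simp add: pgroups_def)
  then have "f \<one>\<^bsub>?U\<^esub> = \<one>\<^bsub>K\<^esub>" by (rule hom_one[OF K(2) U.is_group])
  with K hg g have "f (h g) \<noteq> \<one>\<^bsub>K\<^esub>"
    using inj_onD[OF K(3), of "h g" "\<one>\<^bsub>?U\<^esub>"] by auto
  moreover have "f \<circ> h \<in> hom G K"
    using h K(2) by (auto simp: hom_def)
  ultimately show ?thesis using K(1) by (intro bexI[of _ K] bexI[of _ "f \<circ> h"]) auto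
qed

end

section \<open>The pro-p topology\<close>

text \<open>For a subbasic set, \<open>M\<close> is the exponent in the order \<open>p ^ M\<close>
  of the target group, where \<open>y ^ n\<close> becomes trivial by Lagrange; a binary intersection
  takes the larger \<open>M\<close>. The bound is uniform in \<open>y\<close>.\<close>

lemma (in group) pro_topology_pow_neighbourhood:
  assumes "openin (pro_topology (pgroups p) G) U" "x \<in> U"
  shows "\<exists>M. \<forall>y\<in>carrier G. \<forall>n::int. int p ^ M dvd n \<longrightarrow> x \<otimes> y [^] n \<in> U"
proof -
  define B where "B = {{x \<in> carrier G. h x \<in> A} |H h A. H \<in> pgroups p \<and> h \<in> hom G H \<and> A \<subseteq> carrier H}"
  have "generate_topology_on B U"
    using openin_topology_generated_by[of B U] assms(1) by (simp add: pro_topology_def B_def)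
  then show ?thesis
    using assms(2)
  proof (induction arbitrary: x)
    case (Int U V)
    obtain M where
      M: "\<forall>y\<in>carrier G. \<forall>n::int. int p ^ M dvd n \<longrightarrow> x \<otimes> y [^] n \<in> U"
      using Int.IH(1)[of x] Int.prems by blast
    obtain N where
      N: "\<forall>y\<in>carrier G. \<forall>n::int. int p ^ N dvd n \<longrightarrow> x \<otimes> y [^] n \<in> V"
      using Int.IH(2)[of x] Int.prems by blast
    have "int p ^ M dvd n" "int p ^ N dvd n" if "int p ^ max M N dvd n" for n :: int
      using dvd_trans[OF le_imp_power_dvd that] by simp_all
    with M N show ?case by (intro exI[of _ "max M N"]) blast
  next
    case (UN K)
    then obtain U where U: "U \<in> K" "x \<in> U" by blast
    from UN.IH[OF this] obtain M where
      "\<forall>y\<in>carrier G. \<forall>n::int. int p ^ M dvd n \<longrightarrow> x \<otimes> y [^] n \<in> U" by blast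
    with U show ?case by (intro exI[of _ M]) blast
  next
    case (Basis s)
    then obtain H h A where H: "H \<in> pgroups p" and h: "h \<in> hom G H" and
      s: "s = {x \<in> carrier G. h x \<in> A}" "A \<subseteq> carrier H"
      by (auto simp: B_def)
    interpret H: group H using H by (simp add: pgroups_def)
    interpret h: group_hom G H h
      using h by (simp add: group_hom_def group_hom_axioms_def is_group H.is_group)
    obtain M where M: "order H = p ^ M" using H by (auto simp: pgroups_def)
    have "x \<otimes> y [^] n \<in> s" if y: "y \<in> carrier G" and n: "int p ^ M dvd n" for y and n :: int
    proof -
      from n obtain c where c: "n = int (order H) * c" by (auto simp: M)
      have "h (y [^] n) = (h y [^]\<^bsub>H\<^esub> int (order H)) [^]\<^bsub>H\<^esub> c"
        using y c by (simp add: h.hom_int_pow H.int_pow_pow)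
      also have "\<dots> = \<one>\<^bsub>H\<^esub>"
        using y by (simp add: int_pow_int H.pow_order_eq_1)
      finally show ?thesis using y Basis.prems s by auto
    qed
    then show ?case by blast
  qed simp
qed

text \<open>The constant map to the trivial group, which has order \<open>p ^ 0\<close>, shows that
  the whole carrier is a subbasic open set.\<close>

lemma (in group) topspace_pro_topology: "topspace (pro_topology (pgroups p) G) = carrier G"
proof -
  let ?T = "\<lparr>carrier = {0 :: nat}, monoid.mult = (\<lambda>_ _. 0), one = 0\<rparr>"
  have "group ?T" by (rule groupI) auto
  moreover have "order ?T = p ^ 0" by (simp add: order_def)
  ultimately have "?T \<in> pgroups p" unfolding pgroups_def by fastforce
  moreover have "(\<lambda>_. 0) \<in> hom G ?T" by (rule homI) auto
  ultimately have "carrier G \<in> {{x \<in> carrier G. h x \<in> A} |H h A. H \<in> pgroups p \<and> h \<in> hom G H \<and> A \<subseteq> carrier H}"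
    by (intro CollectI exI[of _ ?T] exI[of _ "\<lambda>_. 0"] exI[of _ "{0}"]) auto
  then show ?thesis
    unfolding pro_topology_def topology_generated_by_topspace by blast
qed

lemma (in group) notin_pro_closure:
  assumes "H \<in> pgroups p" "h \<in> hom G H" "x \<in> carrier G" "S \<subseteq> carrier G" "h x \<notin> h ` S"
  shows "x \<notin> pro_topology (pgroups p) G closure_of S"
proof -
  let ?T = "{y \<in> carrier G. h y \<in> carrier H - h ` S}"
  have "openin (pro_topology (pgroups p) G) ?T"
    unfolding pro_topology_def by (rule topology_generated_by_Basis) (use assms(1,2) in blast)
  moreover have "x \<in> ?T" using assms by (auto simp: hom_def)
  moreover have "?T \<inter> S = {}" by auto
  ultimately show ?thesis
    using openin_Int_closure_of_eq_empty[of "pro_topology (pgroups p) G" ?T S] by blast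
qed

lemma (in group) generate_eq_range: "a \<in> carrier G \<Longrightarrow> generate G {a} = range (\<lambda>k::int. a [^] k)"
  by (auto simp: generate_pow)

section \<open>Closures of cyclic subgroups\<close>

context based_free_group
begin

text \<open>If \<open>x\<close> and \<open>w\<close> do not commute, some \<open>p\<close>-quotient
  does not kill \<open>x w (w x)^-1\<close>. There the image of \<open>x\<close> does not commute
  with that of \<open>w\<close>, so it is not a power of it.\<close>

lemma commute_of_pro_closure:
  assumes p: "prime p" and w: "w \<in> carrier G"
    and x: "x \<in> pro_topology (pgroups p) G closure_of generate G {w}"
  shows "x \<in> carrier G" "x \<otimes> w = w \<otimes> x"
proof -
  let ?T = "pro_topology (pgroups p) G"
  show xG: "x \<in> carrier G"
    using x closure_of_subset_topspace[of ?T] by (auto simp: topspace_pro_topology)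
  show "x \<otimes> w = w \<otimes> x"
  proof (rule ccontr)
    assume neq: "x \<otimes> w \<noteq> w \<otimes> x"
    let ?c = "x \<otimes> w \<otimes> inv (w \<otimes> x)"
    have "?c \<noteq> \<one>"
    proof
      assume "?c = \<one>"
      then have "inv (inv (w \<otimes> x)) = x \<otimes> w"
        using xG w by (intro inv_equality) auto
      with neq xG w show False by simp
    qed
    then obtain H h where H: "H \<in> pgroups p" "h \<in> hom G H" "h ?c \<noteq> \<one>\<^bsub>H\<^esub>"
      using residually_p[OF p, of ?c] xG w by auto
    interpret H: group H using H by (simp add: pgroups_def)
    interpret h: group_hom G H h
      using H by (simp add: group_hom_def group_hom_axioms_def is_group H.is_group)
    have "h x \<noteq> h (w [^] (k::int))" for k
    proof
      assume eq: "h x = h (w [^] k)"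
      have "w [^] k \<otimes> w = w \<otimes> w [^] k"
        using int_pow_commute[OF w, of k 1] w by simp
      then have "h (w [^] k) \<otimes>\<^bsub>H\<^esub> h w = h w \<otimes>\<^bsub>H\<^esub> h (w [^] k)"
        using w by (metis h.hom_mult int_pow_closed)
      then have "h (x \<otimes> w) = h (w \<otimes> x)"
        using eq xG w by simp
      then have "h ?c = h (w \<otimes> x) \<otimes>\<^bsub>H\<^esub> inv\<^bsub>H\<^esub> h (w \<otimes> x)"
        using xG w by (simp del: h.hom_mult add: h.hom_mult[of "x \<otimes> w"])
      also have "\<dots> = \<one>\<^bsub>H\<^esub>"
        using xG w by (intro H.r_inv) simp
      finally show False using H(3) by simp
    qed
    then have "x \<notin> ?T closure_of generate G {w}"
      using H xG w by (intro notin_pro_closure[of H _ h]) (auto simp: generate_eq_range)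
    with x show False by simp
  qed
qed

lemma pro_closure_cyclic:
  assumes p: "prime p" and w: "w \<in> carrier G" "w \<noteq> \<one>"
  shows "pro_topology (pgroups p) G closure_of generate G {w} =
    generate G {elem_root G w [^] p_part p (elem_exp G w)}"
    (is "?T closure_of _ = generate G {?u [^] ?q}")
proof -
  let ?e = "elem_exp G w"
  have u: "?u \<in> carrier G" "?u \<noteq> \<one>" and e: "?e \<ge> 1" and ue: "?u [^] ?e = w"
    using elem_root_closed[OF w] elem_root_neq_one[OF w] elem_exp_pos[OF w] elem_root_pow[OF w] by auto
  obtain e' where e': "?e = ?q * e'" "\<not> p dvd e'"
    using multiplicity_decompose'[of ?e p] e p unfolding p_part_def
    by (metis not_one_le_zero not_prime_unit)
  have wk: "w [^] k = ?u [^] (int ?e * k)" for k :: int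
    using u ue by (metis int_pow_int int_pow_pow)
  have qk: "(?u [^] ?q) [^] k = ?u [^] (int ?q * k)" for k :: int
    using u by (metis int_pow_int int_pow_pow)
  have gw: "generate G {w} = range (\<lambda>k. ?u [^] (int ?e * k))"
    using w by (simp add: generate_eq_range wk)
  have gq: "generate G {?u [^] ?q} = range (\<lambda>k. ?u [^] (int ?q * k))"
    using u by (simp add: generate_eq_range qk)
  show ?thesis
  proof (intro equalityI subsetI)
    fix x assume x: "x \<in> ?T closure_of generate G {w}"
    obtain k :: int where k: "x = ?u [^] k"
      using commute_imp_power_of_root[OF w] commute_of_pro_closure[OF p w(1) x] by blast
    have "?u [^] int ?q \<noteq> \<one>"
      using int_pow_inject[OF u, of "int ?q" 0] p by (auto simp: p_part_def)
    then have "?u [^] ?q \<noteq> \<one>" by (simp add: int_pow_int)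
    then obtain H h where H: "H \<in> pgroups p" "h \<in> hom G H" "h (?u [^] ?q) \<noteq> \<one>\<^bsub>H\<^esub>"
      using residually_p[OF p, of "?u [^] ?q"] u by auto
    interpret H: group H using H by (simp add: pgroups_def)
    interpret h: group_hom G H h
      using H by (simp add: group_hom_def group_hom_axioms_def is_group H.is_group)
    \<comment> \<open>In this quotient \<open>x\<close> must agree with some element of the subgroup
      generated by \<open>w\<close>; this compares exponents modulo the order of
      \<open>h u\<close>.\<close>
    have "h x \<in> h ` generate G {w}"
      using notin_pro_closure[OF H(1,2), of x "generate G {w}"] x u w k
      by (auto simp: generate_eq_range)
    then obtain j where "h x = h (?u [^] (int ?e * j))"
      by (auto simp: gw)
    then have "h ?u [^]\<^bsub>H\<^esub> k = h ?u [^]\<^bsub>H\<^esub> (int ?e * j)"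
      using u by (simp add: k h.hom_int_pow)
    then have dvd: "int (H.ord (h ?u)) dvd k - int ?e * j"
      using u H.int_pow_eq[of "h ?u"] by (simp add: dvd_diff_commute)
    obtain N where "order H = p ^ N" using H by (auto simp: pgroups_def)
    then obtain M where M: "H.ord (h ?u) = p ^ M"
      using H.ord_dvd_group_order[of "h ?u"] u p by (auto simp: divides_primepow_nat)
    text \<open>The order of \<open>h u\<close> exceeds the \<open>p\<close>-part of \<open>e\<close>, so it is a multiple of it.\<close>
    have "\<not> p ^ M dvd ?q"
      using H(3) u H.pow_eq_id[of "h ?u" ?q] by (simp add: h.hom_nat_pow M)
    then have "multiplicity p ?e \<le> M"
      unfolding p_part_def by (meson le_imp_power_dvd nat_le_linear)
    then have "?q dvd p ^ M"
      unfolding p_part_def by (rule le_imp_power_dvd)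
    with dvd M have "int ?q dvd k - int ?e * j"
      by (metis dvd_trans int_dvd_int_iff)
    moreover have "int ?q dvd int ?e * j"
      by (subst e'(1)) simp
    ultimately have "int ?q dvd k" by (metis dvd_add_right_iff diff_add_cancel dvd_add)
    with k gq show "x \<in> generate G {?u [^] ?q}" by auto
  next
    fix x assume "x \<in> generate G {?u [^] ?q}"
    then obtain k where k: "x = ?u [^] (int ?q * k)" by (auto simp: gq)
    have "\<exists>y. y \<in> generate G {w} \<and> y \<in> U" if U: "x \<in> U" "openin ?T U" for U
    proof -
      obtain M where M: "\<forall>y\<in>carrier G. \<forall>n::int. int p ^ M dvd n \<longrightarrow> x \<otimes> y [^] n \<in> U"
        using pro_topology_pow_neighbourhood[OF U(2,1)] by blast
      have "coprime (int e') (int p ^ M)"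
        using e'(2) p by (simp add: prime_imp_coprime coprime_commute[of e' p])
      \<comment> \<open>Multiplying \<open>x = u ^ (q * k)\<close> by
        \<open>u ^ (q * k * (e' * c - 1))\<close> gives
        \<open>u ^ (q * e' * k * c) = w ^ (k * c)\<close>. The correcting exponent is divisible by
        \<open>p ^ M\<close>, so the product stays in \<open>U\<close>.\<close>
      then obtain c where c: "[int e' * c = 1] (mod int p ^ M)"
        using cong_solve_coprime_int by blast
      then have "int p ^ M dvd int e' * c - 1" by (simp add: cong_iff_dvd_diff)
      then have "x \<otimes> ?u [^] (int ?q * k * (int e' * c - 1)) \<in> U"
        using M u by simp
      also have "x \<otimes> ?u [^] (int ?q * k * (int e' * c - 1)) = ?u [^] (int ?e * (k * c))"
        using u by (subst e'(1)) (simp add: k int_pow_mult[symmetric] algebra_simps)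
      finally show ?thesis using gw by blast
    qed
    then show "x \<in> ?T closure_of generate G {w}"
      using u k by (simp add: in_closure_of topspace_pro_topology)
  qed
qed

lemma pro_closure_trivial:
  assumes p: "prime p"
  shows "pro_topology (pgroups p) G closure_of {\<one>} = {\<one>}"
proof (intro equalityI subsetI)
  fix x assume x: "x \<in> pro_topology (pgroups p) G closure_of {\<one>}"
  then have xG: "x \<in> carrier G"
    using closure_of_subset_topspace[of "pro_topology (pgroups p) G"]
    by (auto simp: topspace_pro_topology)
  show "x \<in> {\<one>}"
  proof (rule ccontr)
    assume "x \<notin> {\<one>}"
    then obtain H h where H: "H \<in> pgroups p" "h \<in> hom G H" "h x \<noteq> \<one>\<^bsub>H\<^esub>"
      using residually_p[OF p xG] by auto
    then have "h \<one> = \<one>\<^bsub>H\<^esub>"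
      by (intro hom_one[of h G H] is_group) (auto simp: pgroups_def)
    with notin_pro_closure[OF H(1,2) xG, of "{\<one>}"] H(3) x show False by auto
  qed
next
  fix x assume "x \<in> {\<one>}"
  then show "x \<in> pro_topology (pgroups p) G closure_of {\<one>}"
    using closure_of_subset[of "{\<one>}" "pro_topology (pgroups p) G"]
    by (auto simp: topspace_pro_topology)
qed

text \<open>Forward, \<open>v\<close> turns out to be \<open>u ^ k\<close> with \<open>e\<close>
  dividing \<open>k * q\<close>, and \<open>e = p ^ s\<close> is coprime to \<open>q\<close>.
  Conversely, a prime factor \<open>q\<close> of \<open>e\<close> other than \<open>p\<close> is
  refuted by \<open>v = u ^ (e / q)\<close>, whose \<open>q\<close>-th power is
  \<open>w\<close>.\<close>

lemma root_closed_iff: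
  assumes p: "prime p" and w: "w \<in> carrier G" "w \<noteq> \<one>"
  shows "(\<exists>s. elem_exp G w = p ^ s) \<longleftrightarrow>
    (\<forall>v\<in>carrier G. \<forall>q. prime q \<and> q \<noteq> p \<longrightarrow>
       v [^] q \<in> generate G {w} \<longrightarrow> v \<in> generate G {w})"
    (is "?l \<longleftrightarrow> ?r")
proof
  let ?u = "elem_root G w" and ?e = "elem_exp G w"
  have u: "?u \<in> carrier G" "?u \<noteq> \<one>" and e: "?e \<ge> 1" and ue: "?u [^] ?e = w"
    using elem_root_closed[OF w] elem_root_neq_one[OF w] elem_exp_pos[OF w] elem_root_pow[OF w] by auto
  have wk: "w [^] k = ?u [^] (int ?e * k)" for k :: int
    using u ue by (metis int_pow_int int_pow_pow)
  have gw: "generate G {w} = range (\<lambda>k. ?u [^] (int ?e * k))"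
    using w by (simp add: generate_eq_range wk)
  show ?r if ?l
  proof (intro ballI allI impI, elim conjE)
    fix v q assume v: "v \<in> carrier G" and q: "prime q" "q \<noteq> p" and vq: "v [^] q \<in> generate G {w}"
    obtain s where s: "?e = p ^ s" using \<open>?l\<close> by blast
    obtain j :: int where j: "v [^] q = w [^] j"
      using vq w by (auto simp: generate_eq_range)
    show "v \<in> generate G {w}"
    \<comment> \<open>Commutation of \<open>v\<close> with \<open>w\<close> is deduced through
      \<open>v ^ q\<close>, which must be nontrivial for \<open>commute_trans\<close>.\<close>
    proof (cases "v [^] q = \<one>")
      case True
      with torsion_free[OF v] q(1) have "v = \<one>" by (simp add: prime_gt_0_nat)
      then show ?thesis using w by (simp add: generate.one)
    next
      case False
      have 1: "w \<otimes> v [^] q = v [^] q \<otimes> w"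
        using int_pow_commute[OF w(1), of 1 j] w by (simp add: j)
      have 2: "v \<otimes> v [^] q = v [^] q \<otimes> v"
        using nat_pow_Suc2[OF v, of q] by simp
      have "v \<otimes> w = w \<otimes> v"
        using commute_trans[OF v w(1) _ False 2 1] v by simp
      then obtain k where k: "v = ?u [^] (k::int)"
        using commute_imp_power_of_root[OF w v] by blast
      have "?u [^] (k * int q) = ?u [^] (int ?e * j)"
        using j u by (metis k wk int_pow_int int_pow_pow)
      then have "k * int q = int ?e * j"
        using int_pow_inject[OF u] by blast
      then have "int ?e dvd k * int q" by simp
      moreover have "coprime (int ?e) (int q)"
        using q p s by (simp add: primes_coprime)
      ultimately have "int ?e dvd k"
        by (simp add: coprime_dvd_mult_left_iff)
      with k gw show ?thesis by auto
    qed
  qed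
  show ?l if ?r
  proof -
    have "q = p" if q: "prime q" "q dvd ?e" for q
    proof (rule ccontr)
      assume "q \<noteq> p"
      obtain d where d: "?e = d * q" using q(2) by (auto simp: dvd_def mult.commute)
      have "(?u [^] d) [^] q = w"
        using u ue d by (simp add: nat_pow_pow)
      then have "(?u [^] d) [^] q \<in> generate G {w}"
        by (simp add: generate.incl)
      then have "?u [^] d \<in> generate G {w}"
        using \<open>?r\<close> u q(1) \<open>q \<noteq> p\<close> by blast
      then obtain k where "?u [^] d = ?u [^] (int ?e * k)" by (auto simp: gw)
      then have "int d = int ?e * k"
        using int_pow_inject[OF u, of "int d"] by (simp add: int_pow_int)
      then have "int d * (int q * k) = int d * 1"
        by (simp add: d mult.assoc)
      then have "int q * k = 1"
        using e d by (subst (asm) mult_left_cancel) auto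
      then have "int q dvd 1" by (metis dvd_triv_left)
      with q(1) show False by (simp add: prime_gt_Suc_0_nat)
    qed
    moreover obtain e' where e': "?e = p ^ multiplicity p ?e * e'" "\<not> p dvd e'"
      using multiplicity_decompose'[of ?e p] e p by (metis not_one_le_zero not_prime_unit)
    \<comment> \<open>A prime factor of \<open>e'\<close> divides \<open>e\<close>, hence equals
      \<open>p\<close>, which does not divide \<open>e'\<close>.\<close>
    ultimately have "e' = 1"
      by (metis dvd_triv_right dvd_trans prime_factor_nat)
    with e' show ?thesis by (metis mult.right_neutral)
  qed
qed

end

theorem corollary3p6:
  fixes F :: "('a, 'b) monoid_scheme" and p :: nat
  assumes "prime p" and "free_group F"
  shows "pro_topology (pgroups p) F closure_of (generate F {\<one>\<^bsub>F\<^esub>}) = generate F {\<one>\<^bsub>F\<^esub>} \<and>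
    (\<forall>w \<in> carrier F - {\<one>\<^bsub>F\<^esub>}.
       let u = elem_root F w; e = elem_exp F w in
         ((closedin (pro_topology (pgroups p) F) (generate F {w}) \<longleftrightarrow> (\<exists>s. e = p ^ s)) \<and>
          ((\<exists>s. e = p ^ s) \<longleftrightarrow>
             (\<forall>v \<in> carrier F. \<forall>q. prime q \<and> q \<noteq> p \<longrightarrow>
                v [^]\<^bsub>F\<^esub> q \<in> generate F {w} \<longrightarrow> v \<in> generate F {w}))) \<and>
         pro_topology (pgroups p) F closure_of (generate F {w}) = generate F {u [^]\<^bsub>F\<^esub> p_part p e})"
proof -
  from assms(2) obtain X where "group F" "free_basis F X"
    by (auto simp: free_group_def)
  then interpret based_free_group F X
    by (simp add: based_free_group_def based_free_group_axioms_def)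
  let ?T = "pro_topology (pgroups p) F"
  have "closedin ?T (generate F {w}) \<longleftrightarrow> (\<exists>s. elem_exp F w = p ^ s)"
    if w: "w \<in> carrier F" "w \<noteq> \<one>\<^bsub>F\<^esub>" for w
  proof -
    let ?u = "elem_root F w" and ?e = "elem_exp F w"
    have u: "?u \<in> carrier F" "?u \<noteq> \<one>\<^bsub>F\<^esub>" and e: "?e \<ge> 1" and ue: "?u [^]\<^bsub>F\<^esub> ?e = w"
      using elem_root_closed[OF w] elem_root_neq_one[OF w] elem_exp_pos[OF w] elem_root_pow[OF w] by auto
    have "closedin ?T (generate F {w}) \<longleftrightarrow> generate F {?u [^]\<^bsub>F\<^esub> p_part p ?e} = generate F {w}"
      using pro_closure_cyclic[OF assms(1) w] closure_of_eq[of ?T "generate F {w}"] by simp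
    \<comment> \<open>As \<open>u\<close> has infinite order, \<open>u ^ p_part p e\<close> is a
      power of \<open>u ^ e\<close> only if \<open>e\<close> divides its own
      \<open>p\<close>-part.\<close>
    also have "\<dots> \<longleftrightarrow> p_part p ?e = ?e"
    proof
      assume "generate F {?u [^]\<^bsub>F\<^esub> p_part p ?e} = generate F {w}"
      then have "?u [^]\<^bsub>F\<^esub> p_part p ?e \<in> generate F {w}"
        using generate.incl[of "?u [^]\<^bsub>F\<^esub> p_part p ?e" "{?u [^]\<^bsub>F\<^esub> p_part p ?e}" F] by simp
      then obtain k :: int where "?u [^]\<^bsub>F\<^esub> p_part p ?e = (?u [^]\<^bsub>F\<^esub> ?e) [^]\<^bsub>F\<^esub> k"
        using w ue by (auto simp: generate_eq_range)
      then have "?u [^]\<^bsub>F\<^esub> int (p_part p ?e) = ?u [^]\<^bsub>F\<^esub> (int ?e * k)"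
        using u by (metis int_pow_int int_pow_pow)
      then have "int ?e dvd int (p_part p ?e)"
        using int_pow_inject[OF u] by (metis dvd_triv_left)
      moreover have "p_part p ?e dvd ?e"
        unfolding p_part_def by (rule multiplicity_dvd)
      ultimately show "p_part p ?e = ?e" by (simp add: dvd_antisym)
    qed (simp add: ue)
    also have "\<dots> \<longleftrightarrow> (\<exists>s. ?e = p ^ s)"
      using assms(1) by (auto simp: p_part_def) metis
    finally show ?thesis .
  qed
  then show ?thesis
    using pro_closure_trivial[OF assms(1)] pro_closure_cyclic[OF assms(1)]
      root_closed_iff[OF assms(1)]
    by (simp add: Let_def generate_one)
qed

end
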